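(* Let $G$ be a torsion-free abelian group of finite rank. Then there are direct decompositions $G = A_0 \oplus A_1$ in which $A_0$ is completely decomposable and $A_1$ is clipped. Moreover, suppose that $G = A_0 \oplus A_1 = B_0 \oplus B_1$, where $A_0$ and $B_0$ are completely decomposable and $A_1$ and $B_1$ are clipped. Then $A_0 \cong B_0$, and consequently $A_1$ is nearly isomorphic to $B_1$.
   Context: All groups are torsion-free abelian groups of finite rank, where the rank of a group $A$ is $\dim_{\mathbb{Q}}(\mathbb{Q}\otimes_{\mathbb{Z}} A)$. A rank-$1$ group is a group isomorphic to a nonzero additive subgroup of $\mathbb{Q}$. A group is completely decomposable if it is a direct sum of (finitely many, possibly zero) rank-$1$ groups; in particular the zero group is completely decomposable. A group is clipped if it has no direct summand of rank $1$; in particular the zero group is clipped. Groups $A$ and $B$ are nearly isomorphic if there exists a torsion-free abelian group $K$ of finite rank such that $A \oplus K \cong B \oplus K$. *)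

theory Defs
  imports
    "HOL-Algebra.Free_Abelian_Groups"
    "HOL-Algebra.Product_Groups"
    "Jordan_Normal_Form.VS_Connect"
begin

text \<open>Abelian groups are the multiplicatively written commutative groups of HOL-Algebra.\<close>

definition torsion_free :: "('a, 'm) monoid_scheme \<Rightarrow> bool" where
  "torsion_free A \<longleftrightarrow>
     (\<forall>a\<in>carrier A. \<forall>n::nat. n > 0 \<longrightarrow> a [^]\<^bsub>A\<^esub> n = \<one>\<^bsub>A\<^esub> \<longrightarrow> a = \<one>\<^bsub>A\<^esub>)"

text \<open>
  The tensor product of the additive group of the rationals with \<open>A\<close> over the integers is the
  free abelian group on the pairs \<open>(q, a)\<close> modulo the biadditivity relations (over the integers
  these imply that scalars can be moved across). The rationals act by
  \<open>r \<odot> (q \<otimes> a) = (r * q) \<otimes> a\<close>.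
\<close>

abbreviation tensor_free :: "('a, 'm) monoid_scheme \<Rightarrow> (rat \<times> 'a \<Rightarrow>\<^sub>0 int) monoid" where
  "tensor_free A \<equiv> free_Abelian_group (UNIV \<times> carrier A)"

definition tensor_relations :: "('a, 'm) monoid_scheme \<Rightarrow> (rat \<times> 'a \<Rightarrow>\<^sub>0 int) set" where
  "tensor_relations A =
     {frag_of (p + q, a) - frag_of (p, a) - frag_of (q, a) | p q a. a \<in> carrier A} \<union>
     {frag_of (q, a \<otimes>\<^bsub>A\<^esub> b) - frag_of (q, a) - frag_of (q, b) | q a b.
        a \<in> carrier A \<and> b \<in> carrier A}"

definition tensor_null :: "('a, 'm) monoid_scheme \<Rightarrow> (rat \<times> 'a \<Rightarrow>\<^sub>0 int) set" where
  "tensor_null A = generate (tensor_free A) (tensor_relations A)"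

definition tensor_scale :: "rat \<Rightarrow> (rat \<times> 'a \<Rightarrow>\<^sub>0 int) \<Rightarrow> (rat \<times> 'a \<Rightarrow>\<^sub>0 int)" where
  "tensor_scale r = frag_extend (\<lambda>(q, a). frag_of (r * q, a))"

text \<open>
  Elements are cosets, so \<open>smult\<close> collects the cosets of the scaled representatives, all of which
  coincide. The fields \<open>mult\<close> and \<open>one\<close> are only there because module records extend ring
  records; no module notion refers to them.
\<close>

definition rat_tensor ::
    "('a, 'm) monoid_scheme \<Rightarrow> (rat, (rat \<times> 'a \<Rightarrow>\<^sub>0 int) set) module" where
  "rat_tensor A =
     \<lparr>carrier = carrier (tensor_free A Mod tensor_null A),
      mult = undefined, one = undefined,
      zero = \<one>\<^bsub>tensor_free A Mod tensor_null A\<^esub>,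
      add = (\<lambda>C D. C \<otimes>\<^bsub>tensor_free A Mod tensor_null A\<^esub> D),
      smult = (\<lambda>r C. \<Union>c\<in>C. tensor_null A #>\<^bsub>tensor_free A\<^esub> tensor_scale r c)\<rparr>"

lemma tensor_scale_add: "tensor_scale r (x + y) = tensor_scale r x + tensor_scale r y"
  by (simp add: tensor_scale_def frag_extend_add)

lemma tensor_scale_diff: "tensor_scale r (x - y) = tensor_scale r x - tensor_scale r y"
  by (simp add: tensor_scale_def frag_extend_diff)

lemma tensor_scale_of: "tensor_scale r (frag_of (q, a)) = frag_of (r * q, a)"
  by (simp add: tensor_scale_def)

lemma tensor_scale_zero: "tensor_scale r 0 = 0"
  by (simp add: tensor_scale_def)

lemma tensor_scale_minus: "tensor_scale r (-x) = - tensor_scale r x"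
  by (metis diff_0 tensor_scale_diff tensor_scale_zero)

context comm_group
begin

lemma comm_group_tensor_free: "comm_group (tensor_free G)" by (rule abelian_free_Abelian_group)

lemma tensor_relations_subset: "tensor_relations G \<subseteq> carrier (tensor_free G)"
proof -
  have diff: "x - y \<in> carrier (tensor_free G)"
    if "x \<in> carrier (tensor_free G)" "y \<in> carrier (tensor_free G)"
    for x y :: "rat \<times> 'a \<Rightarrow>\<^sub>0 int"
    using that keys_diff[of x y] by (simp only: carrier_free_Abelian_group_iff) blast
  show ?thesis
    unfolding tensor_relations_def by (auto intro!: diff simp del: carrier_free_Abelian_group_iff)
qed

lemma subgroup_tensor_null: "subgroup (tensor_null G) (tensor_free G)" unfolding tensor_null_def
  using tensor_relations_subset group.generate_is_subgroup[OF group_free_Abelian_group] by blast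

lemma normal_tensor_null: "tensor_null G \<lhd> tensor_free G"
  using comm_group_tensor_free subgroup_tensor_null comm_group.subgroup_imp_normal by blast

lemma tensor_scale_closed:
  "x \<in> carrier (tensor_free G) \<Longrightarrow> tensor_scale r x \<in> carrier (tensor_free G)"
  unfolding carrier_free_Abelian_group_iff
proof (induction x rule: frag_induction)
  case (diff a b)
  then show ?case
    using keys_diff[of "tensor_scale r a" "tensor_scale r b"] unfolding tensor_scale_diff by blast
qed (auto simp: tensor_scale_zero tensor_scale_of)

lemma tensor_scale_relations:
  assumes "h \<in> tensor_relations G"
  shows "tensor_scale r h \<in> tensor_relations G"
proof -
  consider (left) p q a where "a \<in> carrier G"
      "h = frag_of (p + q, a) - frag_of (p, a) - frag_of (q, a)"
    | (right) q a b where "a \<in> carrier G" "b \<in> carrier G"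
      "h = frag_of (q, a \<otimes> b) - frag_of (q, a) - frag_of (q, b)"
    using assms unfolding tensor_relations_def by blast
  then show ?thesis
  proof cases
    case left
    then have "tensor_scale r h = frag_of (r * p + r * q, a) - frag_of (r * p, a) - frag_of (r * q, a)"
      by (simp only: tensor_scale_diff tensor_scale_of distrib_left)
    then show ?thesis
      using left(1) unfolding tensor_relations_def by blast
  next
    case right
    then have "tensor_scale r h = frag_of (r * q, a \<otimes> b) - frag_of (r * q, a) - frag_of (r * q, b)"
      by (simp only: tensor_scale_diff tensor_scale_of)
    then show ?thesis
      using right(1,2) unfolding tensor_relations_def by blast
  qed
qed

lemma tensor_scale_null: "x \<in> tensor_null G \<Longrightarrow> tensor_scale r x \<in> tensor_null G"
  unfolding tensor_null_def
proof (induction rule: generate.induct)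
  case one
  show ?case
    using generate.one[of "tensor_free G" "tensor_relations G"]
    by (simp only: one_free_Abelian_group tensor_scale_zero)
next
  case (incl h)
  then show ?case by (rule generate.incl[OF tensor_scale_relations])
next
  case (inv h)
  have h: "Poly_Mapping.keys h \<subseteq> UNIV \<times> carrier G"
    using subsetD[OF tensor_relations_subset inv] by (simp only: carrier_free_Abelian_group_iff)
  have rh: "Poly_Mapping.keys (tensor_scale r h) \<subseteq> UNIV \<times> carrier G"
    using tensor_scale_closed[unfolded carrier_free_Abelian_group_iff, OF h] .
  have "inv\<^bsub>tensor_free G\<^esub> tensor_scale r h \<in> generate (tensor_free G) (tensor_relations G)"
    by (rule generate.inv[OF tensor_scale_relations[OF inv]])
  then show ?case
    by (simp only: inv_free_Abelian_group[OF h] inv_free_Abelian_group[OF rh] tensor_scale_minus)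
next
  case (eng a b)
  then show ?case
    using generate.eng[OF eng.IH] by (simp only: mult_free_Abelian_group tensor_scale_add)
qed

lemma tensor_coset_eqI:
  assumes "x \<in> carrier (tensor_free G)" "y \<in> carrier (tensor_free G)" "x - y \<in> tensor_null G"
  shows "tensor_null G #>\<^bsub>tensor_free G\<^esub> x = tensor_null G #>\<^bsub>tensor_free G\<^esub> y"
proof -
  have "x = (x - y) \<otimes>\<^bsub>tensor_free G\<^esub> y" by simp
  then have "x \<in> tensor_null G #>\<^bsub>tensor_free G\<^esub> y"
    using assms(3) unfolding r_coset_def by blast
  then show ?thesis
    using group.repr_independence[OF group_free_Abelian_group _ assms(2) subgroup_tensor_null]
    by metis
qed

lemma tensor_free_add_closed:
  assumes "c \<in> carrier (tensor_free G)" "d \<in> carrier (tensor_free G)"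
  shows "c + d \<in> carrier (tensor_free G)"
  using monoid.m_closed[OF group.is_monoid[OF group_free_Abelian_group] assms]
  by (simp only: mult_free_Abelian_group)

lemma smult_rat_tensor:
  assumes "c \<in> carrier (tensor_free G)"
  shows "r \<odot>\<^bsub>rat_tensor G\<^esub> (tensor_null G #>\<^bsub>tensor_free G\<^esub> c) = tensor_null G #>\<^bsub>tensor_free G\<^esub> tensor_scale r c"
proof -
  have "tensor_null G #>\<^bsub>tensor_free G\<^esub> tensor_scale r x = tensor_null G #>\<^bsub>tensor_free G\<^esub> tensor_scale r c"
    if x: "x \<in> tensor_null G #>\<^bsub>tensor_free G\<^esub> c" for x
  proof -
    obtain h where h: "h \<in> tensor_null G" "x = h + c"
      using x unfolding r_coset_def mult_free_Abelian_group by blast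
    have "h \<in> carrier (tensor_free G)"
      by (rule subgroup.mem_carrier[OF subgroup_tensor_null h(1)])
    then have x': "x \<in> carrier (tensor_free G)"
      unfolding h(2) using assms by (rule tensor_free_add_closed)
    have "tensor_scale r x - tensor_scale r c = tensor_scale r h"
      by (simp add: h(2) tensor_scale_add)
    then show ?thesis
      using tensor_coset_eqI[OF tensor_scale_closed[OF x'] tensor_scale_closed[OF assms]]
        tensor_scale_null[OF h(1)] by (simp only:)
  qed
  moreover have "c \<in> tensor_null G #>\<^bsub>tensor_free G\<^esub> c"
    by (rule group.rcos_self[OF group_free_Abelian_group assms subgroup_tensor_null])
  ultimately show ?thesis
    unfolding rat_tensor_def module.simps by blast
qed

lemma carrier_rat_tensor_iff:
  "C \<in> carrier (rat_tensor G) \<longleftrightarrow> (\<exists>c\<in>carrier (tensor_free G). C = tensor_null G #>\<^bsub>tensor_free G\<^esub> c)"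
  by (simp add: rat_tensor_def FactGroup_def RCOSETS_def del: carrier_free_Abelian_group_iff)

lemma add_rat_tensor:
  assumes "c \<in> carrier (tensor_free G)" "d \<in> carrier (tensor_free G)"
  shows "(tensor_null G #>\<^bsub>tensor_free G\<^esub> c) \<oplus>\<^bsub>rat_tensor G\<^esub> (tensor_null G #>\<^bsub>tensor_free G\<^esub> d) =
    tensor_null G #>\<^bsub>tensor_free G\<^esub> (c + d)"
  using normal.rcos_sum[OF normal_tensor_null assms] by (simp add: rat_tensor_def FactGroup_def)

lemma tensor_scale_distrib:
  "x \<in> carrier (tensor_free G) \<Longrightarrow>
    tensor_scale (r + s) x - (tensor_scale r x + tensor_scale s x) \<in> tensor_null G"
  unfolding carrier_free_Abelian_group_iff
proof (induction x rule: frag_induction)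
  case zero
  then show ?case
    using subgroup.one_closed[OF subgroup_tensor_null] by (simp add: tensor_scale_zero)
next
  case (one x)
  obtain q a where x: "x = (q, a)" by (cases x)
  have "frag_of (r * q + s * q, a) - frag_of (r * q, a) - frag_of (s * q, a) \<in> tensor_relations G"
    using one unfolding tensor_relations_def x by blast
  then show ?case
    unfolding x tensor_scale_of tensor_null_def distrib_right diff_diff_eq by (rule generate.incl)
next
  case (diff a b)
  let ?d = "\<lambda>x. tensor_scale (r + s) x - (tensor_scale r x + tensor_scale s x)"
  have eq: "?d (a - b) = ?d a + - ?d b"
    by (simp add: tensor_scale_diff)
  have "Poly_Mapping.keys (?d b) \<subseteq> UNIV \<times> carrier G"
    using subgroup.mem_carrier[OF subgroup_tensor_null diff.IH(2)]
    by (simp only: carrier_free_Abelian_group_iff)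
  then have "- ?d b \<in> tensor_null G"
    using subgroup.m_inv_closed[OF subgroup_tensor_null diff.IH(2)]
    by (simp only: inv_free_Abelian_group)
  then show ?case
    using subgroup.m_closed[OF subgroup_tensor_null diff.IH(1)]
    unfolding eq mult_free_Abelian_group by blast
qed

lemma tensor_scale_scale: "tensor_scale r (tensor_scale s x) = tensor_scale (r * s) x"
proof -
  have "Poly_Mapping.keys x \<subseteq> UNIV" by simp
  then show ?thesis
    by (induction x rule: frag_induction)
      (auto simp: tensor_scale_zero tensor_scale_of tensor_scale_diff mult.assoc)
qed

lemma tensor_scale_one: "tensor_scale 1 x = x"
proof -
  have "Poly_Mapping.keys x \<subseteq> UNIV" by simp
  then show ?thesis
    by (induction x rule: frag_induction)
      (auto simp: tensor_scale_zero tensor_scale_of tensor_scale_diff)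
qed

lemma abelian_group_rat_tensor: "abelian_group (rat_tensor G)"
proof -
  let ?Q = "tensor_free G Mod tensor_null G"
  interpret Q: comm_group ?Q
    by (rule comm_group.abelian_FactGroup[OF comm_group_tensor_free subgroup_tensor_null])
  have sel: "carrier (rat_tensor G) = carrier ?Q" "zero (rat_tensor G) = \<one>\<^bsub>?Q\<^esub>"
    "\<And>x y. x \<oplus>\<^bsub>rat_tensor G\<^esub> y = x \<otimes>\<^bsub>?Q\<^esub> y"
    by (simp_all add: rat_tensor_def)
  show ?thesis
    by (rule abelian_groupI; unfold sel)
      (fact Q.m_closed Q.one_closed | simp add: Q.m_ac del: mult_FactGroup one_FactGroup
        | blast intro: Q.l_inv Q.inv_closed)+
qed

lemma vectorspace_rat_tensor: "vectorspace class_ring (rat_tensor G)"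
proof -
  have distrib: "tensor_null G #>\<^bsub>tensor_free G\<^esub> tensor_scale (r + s) c =
      tensor_null G #>\<^bsub>tensor_free G\<^esub> (tensor_scale r c + tensor_scale s c)"
    if "c \<in> carrier (tensor_free G)" for r s c
    by (intro tensor_coset_eqI tensor_scale_distrib tensor_scale_closed tensor_free_add_closed that)
  have "Module.module (class_ring :: rat ring) (rat_tensor G)"
  proof (rule Module.module.intro)
    show "cring (class_ring :: rat ring)" by (rule class_cring.is_cring)
    show "abelian_group (rat_tensor G)" by (rule abelian_group_rat_tensor)
    show "Module.module_axioms (class_ring :: rat ring) (rat_tensor G)"
      by unfold_locales
        (auto simp: carrier_rat_tensor_iff smult_rat_tensor add_rat_tensor tensor_scale_closed
           tensor_free_add_closed tensor_scale_add tensor_scale_scale tensor_scale_one distrib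
           simp del: carrier_free_Abelian_group_iff)
  qed
  then show ?thesis by (intro vectorspace.intro class_field)
qed

end

definition finite_rank :: "('a, 'm) monoid_scheme \<Rightarrow> bool" where
  "finite_rank A \<longleftrightarrow> vectorspace.fin_dim class_ring (rat_tensor A)"

definition tffr_group :: "('a, 'm) monoid_scheme \<Rightarrow> bool" where
  "tffr_group A \<longleftrightarrow> comm_group A \<and> torsion_free A \<and> finite_rank A"

definition rat_group :: "rat monoid" where
  "rat_group = \<lparr>carrier = UNIV, mult = (+), one = 0\<rparr>"

definition rank_one :: "('a, 'm) monoid_scheme \<Rightarrow> bool" where
  "rank_one A \<longleftrightarrow> group A \<and>
     (\<exists>H. subgroup H rat_group \<and> H \<noteq> {0} \<and> A \<cong> rat_group\<lparr>carrier := H\<rparr>)"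

text \<open>
  Taking the rank-one summands on the type \<open>rat\<close> is no restriction: every rank-one group is
  isomorphic to one with that carrier type.
\<close>

definition completely_decomposable :: "('a, 'm) monoid_scheme \<Rightarrow> bool" where
  "completely_decomposable A \<longleftrightarrow>
     (\<exists>(n::nat) (X :: nat \<Rightarrow> rat monoid).
        (\<forall>i<n. rank_one (X i)) \<and> A \<cong> sum_group {..<n} X)"

definition direct_decomposition :: "('a, 'm) monoid_scheme \<Rightarrow> 'a set \<Rightarrow> 'a set \<Rightarrow> bool" where
  "direct_decomposition G A B \<longleftrightarrow>
     subgroup A G \<and> subgroup B G \<and> A <#>\<^bsub>G\<^esub> B = carrier G \<and> A \<inter> B = {\<one>\<^bsub>G\<^esub>}"

definition clipped :: "('a, 'm) monoid_scheme \<Rightarrow> bool" where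
  "clipped A \<longleftrightarrow>
     \<not> (\<exists>B C. direct_decomposition A B C \<and> rank_one (A\<lparr>carrier := B\<rparr>))"

text \<open>
  HOL cannot quantify over all carrier types for \<open>K\<close>. The type \<open>nat \<Rightarrow> rat\<close> suffices: a
  torsion-free abelian group of finite rank \<open>n\<close> embeds in the \<open>n\<close>-th power of the rationals, so
  it has an isomorphic copy there.
\<close>

definition nearly_isomorphic ::
    "('a, 'm) monoid_scheme \<Rightarrow> ('b, 'n) monoid_scheme \<Rightarrow> bool" where
  "nearly_isomorphic A B \<longleftrightarrow>
     (\<exists>K :: (nat \<Rightarrow> rat) monoid. tffr_group K \<and> A \<times>\<times> K \<cong> B \<times>\<times> K)"

end

theory Submission
  imports Defs
begin

text \<open>
  Existence is a maximality argument. Split off rank-one summands as long as possible. The number of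
  summands is bounded: the projections onto them are homomorphisms to the rationals, they extend to
  linear functionals on the tensor product of the rationals with \<open>G\<close>, and they are linearly
  independent there (\<open>rational_frame_length_bounded\<close>). When no further summand can be split off, the
  complement is clipped.
  
  Uniqueness rests on counting, for each nonzero subgroup \<open>T\<close> of the rationals, the summands
  isomorphic to \<open>T\<close> in the two completely decomposable parts (\<open>card_iso_type_le\<close>). If \<open>A\<^sub>0\<close> had more of
  them than \<open>B\<^sub>0\<close>, the homogeneous linear system saying that an element of the larger sum has zero
  coordinates in the smaller one would have a solution \<open>v\<close> in coprime integers
  (\<open>homogeneous_system_unimodular_solution\<close>). Multiplication by \<open>v\<close> embeds \<open>T\<close> into \<open>G\<close>, the
  coefficients of a Bezout identity for \<open>v\<close> give a left inverse, and this left inverse does not see the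
  coordinates in summands of \<open>B\<^sub>0\<close> that are not isomorphic to \<open>T\<close>, because two rank-one groups with
  maps in both directions and nonzero composite are isomorphic (\<open>mutual_maps_imp_iso\<close>). Hence \<open>T\<close>
  would already be a retract of \<open>B\<^sub>1\<close>, although \<open>B\<^sub>1\<close> is clipped. By symmetry the numbers agree for
  every \<open>T\<close>, which matches the summands of \<open>A\<^sub>0\<close> and \<open>B\<^sub>0\<close> and makes these groups isomorphic.
  
  Near isomorphism of the complements follows by adding the completely decomposable part to both.
  That part is realised as a sum of subgroups of the rationals, and what remains to be checked is that
  this sum has finite rank.
\<close>

section \<open>Homogeneous linear systems over the rationals\<close>

text \<open>
  Gaussian elimination: a pivot in one equation eliminates one unknown from all the others.
\<close>

lemma homogeneous_system_nontrivial_solution: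
  fixes q :: "'j \<Rightarrow> 'i \<Rightarrow> rat"
  assumes "finite J" "finite I" "card J < card I"
  shows "\<exists>v. (\<exists>i\<in>I. v i \<noteq> 0) \<and> (\<forall>j\<in>J. (\<Sum>i\<in>I. v i * q j i) = 0)"
  using assms
proof (induction J arbitrary: I q rule: finite_induct)
  case empty
  then have "I \<noteq> {}" by auto
  then show ?case by (intro exI[of _ "\<lambda>_. 1"]) auto
next
  case (insert j0 J)
  show ?case
  proof (cases "\<forall>i\<in>I. q j0 i = 0")
    case True
    have "card J < card I" using insert by simp
    then obtain v where v: "\<exists>i\<in>I. v i \<noteq> 0" "\<forall>j\<in>J. (\<Sum>i\<in>I. v i * q j i) = 0"
      using insert.IH[OF insert.prems(1)] by blast
    then show ?thesis using True by (intro exI[of _ v]) auto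
  next
    case False
    then obtain i0 where i0: "i0 \<in> I" "q j0 i0 \<noteq> 0" by blast
    let ?I = "I - {i0}"
    have "card J < card ?I" using insert i0 by simp
    moreover have "finite ?I" using insert by simp
    ultimately obtain v where v: "\<exists>i\<in>?I. v i \<noteq> 0"
      "\<forall>j\<in>J. (\<Sum>i\<in>?I. v i * (q j i - q j i0 * q j0 i / q j0 i0)) = 0"
      using insert.IH[where I = ?I and q = "\<lambda>j i. q j i - q j i0 * q j0 i / q j0 i0"] by blast
    define c where "c = - (\<Sum>i\<in>?I. v i * q j0 i) / q j0 i0"
    define w where "w = v(i0 := c)"
    have split: "(\<Sum>i\<in>I. w i * q j i) = c * q j i0 + (\<Sum>i\<in>?I. v i * q j i)" for j
      using i0 insert.prems(1) by (subst sum.remove[of _ i0]) (auto simp: w_def intro!: sum.cong)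
    have "(\<Sum>i\<in>I. w i * q j i) = 0" if j: "j \<in> J" for j
    proof -
      have "0 = (\<Sum>i\<in>?I. v i * (q j i - q j i0 * q j0 i / q j0 i0))" using v(2) j by simp
      also have "\<dots> = (\<Sum>i\<in>?I. v i * q j i - (q j i0 / q j0 i0) * (v i * q j0 i))"
        by (intro sum.cong) (auto simp: algebra_simps)
      also have "\<dots> = (\<Sum>i\<in>?I. v i * q j i) - (q j i0 / q j0 i0) * (\<Sum>i\<in>?I. v i * q j0 i)"
        by (simp add: sum_subtractf sum_distrib_left)
      also have "\<dots> = (\<Sum>i\<in>I. w i * q j i)"
        unfolding split c_def by simp
      finally show ?thesis by simp
    qed
    moreover have "(\<Sum>i\<in>I. w i * q j0 i) = 0"
      unfolding split c_def using i0 by simp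
    moreover have "\<exists>i\<in>I. w i \<noteq> 0" using v(1) by (auto simp: w_def)
    ultimately show ?thesis by (intro exI[of _ w]) auto
  qed
qed

lemma Bezout_finite_family:
  fixes w :: "'i \<Rightarrow> int"
  assumes "finite I"
  shows "\<exists>u d. (\<Sum>i\<in>I. u i * w i) = d \<and> (\<forall>i\<in>I. d dvd w i)"
  using assms
proof (induction I rule: finite_induct)
  case (insert x I)
  then obtain u where u: "\<forall>i\<in>I. (\<Sum>i\<in>I. u i * w i) dvd w i" by blast
  let ?d = "\<Sum>i\<in>I. u i * w i"
  obtain s t where st: "s * ?d + t * w x = gcd ?d (w x)" using bezout_int by blast
  define u' where "u' i = (if i = x then t else s * u i)" for i
  have "(\<Sum>i\<in>insert x I. u' i * w i) = t * w x + (\<Sum>i\<in>I. s * (u i * w i))"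
    using insert by (auto simp: u'_def intro!: sum.cong)
  then have "(\<Sum>i\<in>insert x I. u' i * w i) = gcd ?d (w x)"
    using st by (simp add: sum_distrib_left)
  moreover have "\<forall>i\<in>insert x I. gcd ?d (w x) dvd w i" using u by (auto intro: dvd_trans)
  ultimately show ?case by blast
qed auto

text \<open>
  A rational solution can be cleared of denominators and divided by the greatest common divisor of
  its entries. The Bezout coefficients \<open>u\<close> of the resulting unimodular vector \<open>v\<close> are what turns a
  kernel vector into a split embedding in the uniqueness proof.
\<close>

lemma homogeneous_system_unimodular_solution:
  fixes q :: "'j \<Rightarrow> 'i \<Rightarrow> rat"
  assumes "finite J" "finite I" "card J < card I"
  shows "\<exists>u v :: 'i \<Rightarrow> int. (\<Sum>i\<in>I. u i * v i) = 1 \<and>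
           (\<forall>j\<in>J. (\<Sum>i\<in>I. of_int (v i) * q j i) = 0)"
proof -
  obtain r where r: "\<exists>i\<in>I. r i \<noteq> 0" "\<forall>j\<in>J. (\<Sum>i\<in>I. r i * q j i) = 0"
    using homogeneous_system_nontrivial_solution[OF assms] by blast
  define D where "D = (\<Prod>i\<in>I. snd (quotient_of (r i)))"
  define w where "w i = fst (quotient_of (r i)) * (\<Prod>k\<in>I - {i}. snd (quotient_of (r k)))" for i
  have pos: "snd (quotient_of x) > 0" for x by (rule quotient_of_denom_pos')
  have D: "D > 0" unfolding D_def by (intro prod_pos) (simp add: pos)
  have w: "of_int (w i) = of_int D * r i" if "i \<in> I" for i
  proof -
    have "D = snd (quotient_of (r i)) * (\<Prod>k\<in>I - {i}. snd (quotient_of (r k)))"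
      unfolding D_def using assms(2) that by (rule prod.remove)
    moreover have "r i = of_int (fst (quotient_of (r i))) / of_int (snd (quotient_of (r i)))"
      by (rule quotient_of_div) simp
    ultimately show ?thesis
      unfolding w_def using pos[of "r i"] by (simp add: field_simps)
  qed
  obtain u d where d: "(\<Sum>i\<in>I. u i * w i) = d" "\<forall>i\<in>I. d dvd w i"
    using Bezout_finite_family[OF assms(2)] by blast
  obtain i where "i \<in> I" "r i \<noteq> 0" using r(1) by blast
  then have "(of_int (w i) :: rat) \<noteq> 0" using w D by simp
  then have "w i \<noteq> 0" by simp
  then have d0: "d \<noteq> 0" using d(2) \<open>i \<in> I\<close> by auto
  define v where "v i = w i div d" for i
  have dv: "w i = d * v i" if "i \<in> I" for i using d(2) that by (simp add: v_def)
  have "d * (\<Sum>i\<in>I. u i * v i) = (\<Sum>i\<in>I. u i * w i)"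
    unfolding sum_distrib_left by (intro sum.cong) (auto simp: dv algebra_simps)
  then have "(\<Sum>i\<in>I. u i * v i) = 1" using d(1) d0 by simp
  moreover have "(\<Sum>i\<in>I. of_int (v i) * q j i) = 0" if "j \<in> J" for j
  proof -
    have "of_int d * (\<Sum>i\<in>I. of_int (v i) * q j i) = (\<Sum>i\<in>I. of_int (w i) * q j i)"
      unfolding sum_distrib_left by (intro sum.cong) (auto simp: dv algebra_simps)
    also have "\<dots> = of_int D * (\<Sum>i\<in>I. r i * q j i)"
      unfolding sum_distrib_left by (intro sum.cong) (auto simp: w algebra_simps)
    finally show ?thesis using r(2) that d0 by simp
  qed
  ultimately show ?thesis by blast
qed

section \<open>Subgroups of the rationals\<close>

abbreviation rat_sub :: "rat set \<Rightarrow> rat monoid" where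
  "rat_sub T \<equiv> rat_group\<lparr>carrier := T\<rparr>"

lemma rat_group_simps [simp]:
  "mult (rat_sub T) = (+)" "one (rat_sub T) = 0" "mult rat_group = (+)" "one rat_group = 0"
  "carrier rat_group = UNIV"
  by (simp_all add: rat_group_def)

lemma group_rat_group: "group rat_group"
  by (rule groupI) (auto simp: intro: exI[of _ "- x" for x] ab_left_minus)

lemma inv_rat_group [simp]: "inv\<^bsub>rat_group\<^esub> x = - x"
  by (rule group.inv_equality[OF group_rat_group]) auto

text \<open>
  The nonzero subgroups of the rationals: every rank-one group is isomorphic to \<open>rat_sub T\<close> for one
  of these.
\<close>

definition rat_type :: "rat set \<Rightarrow> bool" where
  "rat_type T \<longleftrightarrow> subgroup T rat_group \<and> T \<noteq> {0}"

lemma subgroup_rat_groupI: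
  assumes "0 \<in> T" "\<And>x y. x \<in> T \<Longrightarrow> y \<in> T \<Longrightarrow> x + y \<in> T" "\<And>x. x \<in> T \<Longrightarrow> - x \<in> T"
  shows "subgroup T rat_group"
  by (rule subgroup.intro) (auto simp: assms)

context
  fixes T assumes T: "subgroup T rat_group"
begin

lemma rat_sub_zero: "0 \<in> T"
  using subgroup.one_closed[OF T] by simp

lemma rat_sub_add: "x \<in> T \<Longrightarrow> y \<in> T \<Longrightarrow> x + y \<in> T"
  using subgroup.m_closed[OF T] by simp

lemma rat_sub_minus: "x \<in> T \<Longrightarrow> - x \<in> T"
  using subgroup.m_inv_closed[OF T] by simp

lemma rat_sub_of_int_mult: assumes x: "x \<in> T" shows "of_int k * x \<in> T"
proof (induction k rule: int_induct[of _ 0])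
  case base then show ?case by (simp add: rat_sub_zero)
next
  case (step1 i) then show ?case using rat_sub_add[OF step1(2) x] by (simp add: algebra_simps)
next
  case (step2 i) then show ?case using rat_sub_add[OF step2(2) rat_sub_minus[OF x]] by (simp add: algebra_simps)
qed

lemma rat_sub_sum: "finite I \<Longrightarrow> (\<And>i. i \<in> I \<Longrightarrow> f i \<in> T) \<Longrightarrow> sum f I \<in> T"
  by (induction I rule: finite_induct) (auto simp: rat_sub_zero rat_sub_add)

lemma comm_group_rat_sub: "comm_group (rat_sub T)"
  by (rule comm_groupI)
    (auto simp: rat_sub_zero rat_sub_add intro: bexI[of _ "- x" for x] rat_sub_minus)

lemma hom_rat_sub_of_int_mult:
  assumes h: "h \<in> hom (rat_sub T) (rat_sub Y)" and t: "t \<in> T"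
  shows "h (of_int k * t) = of_int k * h t"
proof -
  have add: "h (x + y) = h x + h y" if "x \<in> T" "y \<in> T" for x y
    using hom_mult[OF h, of x y] that by simp
  have zero: "h 0 = 0" using add[of 0 0] rat_sub_zero by simp
  have minus: "h (- x) = - h x" if "x \<in> T" for x
    using add[of x "- x"] that rat_sub_minus[OF that] zero by simp
  show ?thesis
  proof (induction k rule: int_induct[of _ 0])
    case base then show ?case by (simp add: zero)
  next
    case (step1 i) then show ?case
      using add[OF rat_sub_of_int_mult[OF t, of i] t] by (simp add: algebra_simps)
  next
    case (step2 i) then show ?case
      using add[OF rat_sub_of_int_mult[OF t, of i] rat_sub_minus[OF t]] minus[OF t]
      by (simp add: algebra_simps)
  qed
qed

text \<open>
  Any two nonzero elements of \<open>T\<close> have a common nonzero integer multiple, so the value at one nonzero element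
  determines a homomorphism.
\<close>

lemma hom_rat_sub_is_scaling:
  assumes h: "h \<in> hom (rat_sub T) (rat_sub Y)"
  shows "\<exists>r. \<forall>t\<in>T. h t = r * t"
proof (cases "T = {0}")
  case True
  then show ?thesis using hom_rat_sub_of_int_mult[OF h, of 0 0] by auto
next
  case False
  then obtain t where t: "t \<in> T" "t \<noteq> 0" using rat_sub_zero by blast
  have "h s = h t / t * s" if s: "s \<in> T" for s
  proof -
    obtain a b where ab: "b > 0" "s / t = of_int a / of_int b"
      using quotient_of_denom_pos' quotient_of_div surjective_pairing by metis
    then have eq: "of_int b * s = of_int a * t" using t by (simp add: field_simps)
    then have "of_int b * h s = of_int a * h t"
      using hom_rat_sub_of_int_mult[OF h s, of b] hom_rat_sub_of_int_mult[OF h t(1), of a] by simp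
    then have "of_int b * (h s * t) = of_int b * (h t * s)"
      using eq by (simp add: algebra_simps)
    then show ?thesis using ab t by (simp add: field_simps)
  qed
  then show ?thesis by blast
qed

text \<open>
  A subgroup generated by two rationals is cyclic: over a common denominator, Bezout writes the
  greatest common divisor of the numerators as a combination of them.
\<close>

lemma rat_sub_common_divisor:
  assumes x: "x \<in> T" and y: "y \<in> T"
  shows "\<exists>w\<in>T. \<exists>m n :: int. x = of_int m * w \<and> y = of_int n * w"
proof -
  obtain a b where ab: "b > 0" "x = of_int a / of_int b"
    using quotient_of_denom_pos' quotient_of_div surjective_pairing by metis
  obtain c d where cd: "d > 0" "y = of_int c / of_int d"
    using quotient_of_denom_pos' quotient_of_div surjective_pairing by metis
  define g where "g = gcd (a * d) (c * b)"
  obtain s t where st: "s * (a * d) + t * (c * b) = g"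
    unfolding g_def using bezout_int by blast
  define w where "w = of_int s * x + of_int t * y"
  have x': "of_int b * x = of_int a" and y': "of_int d * y = of_int c"
    using ab cd by simp_all
  have "of_int (b * d) * w = of_int (s * d) * (of_int b * x) + of_int (t * b) * (of_int d * y)"
    unfolding w_def by (simp add: algebra_simps)
  then have w: "of_int (b * d) * w = of_int g"
    unfolding st[symmetric] x' y' by (simp add: algebra_simps)
  obtain m n where m: "a * d = g * m" and n: "c * b = g * n"
    unfolding g_def by (meson dvdE gcd_dvd1 gcd_dvd2)
  have "of_int (b * d) * x = of_int d * (of_int b * x)" by simp
  also have "\<dots> = of_int (a * d)" unfolding x' by simp
  also have "\<dots> = of_int m * (of_int (b * d) * w)" unfolding m w by simp
  finally have "of_int (b * d) * x = of_int (b * d) * (of_int m * w)" by simp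
  then have "x = of_int m * w" using ab cd by simp
  have "of_int (b * d) * y = of_int b * (of_int d * y)" by simp
  also have "\<dots> = of_int (c * b)" unfolding y' by simp
  also have "\<dots> = of_int n * (of_int (b * d) * w)" unfolding n w by simp
  finally have "of_int (b * d) * y = of_int (b * d) * (of_int n * w)" by simp
  then have "y = of_int n * w" using ab cd by simp
  moreover have "w \<in> T" unfolding w_def
    by (intro rat_sub_add rat_sub_of_int_mult x y)
  ultimately show ?thesis using \<open>x = of_int m * w\<close> by blast
qed

end

text \<open>
  Because \<open>T\<close> is locally cyclic, so is its quotient by \<open>N T\<close>, and a subgroup \<open>H\<close> between \<open>N T\<close> and \<open>T\<close>
  has to be \<open>d T\<close>, with \<open>d\<close> the exponent of \<open>T\<close> modulo \<open>H\<close>.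
\<close>

lemma finite_exponent_subgroup_is_multiple:
  assumes T: "subgroup T rat_group" and H: "subgroup H rat_group" "H \<subseteq> T" and N: "N > 0" "(\<lambda>t. of_nat N * t) ` T \<subseteq> H"
  shows "\<exists>d > 0. H = (\<lambda>t. of_nat d * t) ` T"
proof -
  define P where "P d \<longleftrightarrow> d > 0 \<and> (\<forall>t\<in>T. of_nat d * t \<in> H)" for d
  define d where "d = (LEAST d. P d)"
  have "P N" unfolding P_def using N by auto
  then have Pd: "P d" and least: "\<And>e. P e \<Longrightarrow> d \<le> e"
    unfolding d_def by (auto intro: LeastI Least_le)
  have "H \<subseteq> (\<lambda>t. of_nat d * t) ` T"
  proof
    fix h assume h: "h \<in> H"
    \<comment> \<open>Write \<open>h = u z\<close> so that \<open>gcd u d\<close> is as large as possible. Refining \<open>z\<close> cannot enlarge this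
      number \<open>c\<close> any more, which forces \<open>c T \<subseteq> H\<close>. Minimality of \<open>d\<close> then gives \<open>c = d\<close>, so \<open>d\<close> divides \<open>u\<close>.\<close>
    define C where "C = {c. \<exists>z\<in>T. \<exists>u :: int. h = of_int u * z \<and> c = gcd u (int d)}"
    have "C \<subseteq> {0..int d}"
      using Pd by (auto simp: C_def P_def intro!: gcd_le2_int)
    then have fin: "finite C" by (rule finite_subset) simp
    have "h = of_int 1 * h" "h \<in> T" using h H by auto
    then have "gcd 1 (int d) \<in> C" unfolding C_def by blast
    then have "Max C \<in> C" using fin by (intro Max_in) auto
    then obtain z u where z: "z \<in> T" "h = of_int u * z" and c: "Max C = gcd u (int d)"
      unfolding C_def by blast
    let ?c = "gcd u (int d)"
    have "of_int ?c * x \<in> H" if x: "x \<in> T" for x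
    proof -
      obtain w v v' where w: "w \<in> T" "z = of_int v * w" "x = of_int v' * w"
        using rat_sub_common_divisor[OF T z(1) x] by blast
      then have "h = of_int (u * v) * w" using z(2) by simp
      then have "gcd (u * v) (int d) \<in> C" unfolding C_def using w(1) by blast
      then have "gcd (u * v) (int d) \<le> ?c" using fin c by (metis Max_ge)
      moreover have "?c dvd gcd (u * v) (int d)" by (auto intro: dvd_mult2)
      moreover have "gcd (u * v) (int d) > 0" using Pd by (auto simp: P_def)
      ultimately have eq: "gcd (u * v) (int d) = ?c" using zdvd_imp_le by fastforce
      obtain s t where "s * (u * v) + t * int d = ?c" using bezout_int eq by metis
      then have "of_int ?c * w = of_int (s * (u * v) + t * int d) * w" by simp
      also have "\<dots> = of_int s * h + of_int t * (of_nat d * w)"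
        unfolding z(2) w(2) by (simp add: algebra_simps)
      also have "\<dots> \<in> H"
        using Pd w(1) h unfolding P_def
        by (intro rat_sub_add[OF H(1)] rat_sub_of_int_mult[OF H(1)]) auto
      finally have "of_int v' * (of_int ?c * w) \<in> H" by (rule rat_sub_of_int_mult[OF H(1)])
      then show ?thesis unfolding w(3) by (simp add: mult.left_commute)
    qed
    then have "P (nat ?c)" unfolding P_def using Pd by (auto simp: P_def)
    then have "d \<le> nat ?c" by (rule least)
    then have "int d \<le> ?c" by (metis gcd_ge_0_int nat_0_le of_nat_le_iff)
    moreover have "?c \<le> int d" using Pd by (auto simp: P_def intro!: gcd_le2_int)
    ultimately have "int d dvd u" by (metis gcd_dvd1 order_antisym)
    then obtain k where "u = int d * k" by blast
    then have "h = of_nat d * (of_int k * z)" using z by simp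
    then show "h \<in> (\<lambda>t. of_nat d * t) ` T" using rat_sub_of_int_mult[OF T z(1)] by blast
  qed
  then show ?thesis using Pd unfolding P_def by (intro exI[of _ d]) auto
qed

lemma scaling_iso:
  assumes "r \<noteq> 0" "Y = (\<lambda>t. r * t) ` T"
  shows "rat_sub T \<cong> rat_sub Y"
proof -
  have "(\<lambda>t. r * t) \<in> iso (rat_sub T) (rat_sub Y)"
    using assms by (auto simp: iso_def hom_def bij_betw_def inj_on_def algebra_simps)
  then show ?thesis by (auto simp: is_iso_def)
qed

text \<open>
  Both maps are scalings, by \<open>r\<close> and by \<open>s\<close>. If \<open>c\<close> is the numerator of \<open>r s\<close>, then
  \<open>c Y \<subseteq> r T \<subseteq> Y\<close>, hence \<open>r T = d Y\<close> for some positive \<open>d\<close>, and division by \<open>d\<close> makes the first scaling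
  onto. The contrapositive is how this is used: a composite \<open>T \<rightarrow> Y \<rightarrow> T\<close> vanishes unless \<open>T\<close> and \<open>Y\<close>
  are isomorphic.
\<close>

lemma mutual_maps_imp_iso:
  assumes T: "subgroup T rat_group" and Y: "subgroup Y rat_group"
    and f: "f \<in> hom (rat_sub T) (rat_sub Y)" and g: "g \<in> hom (rat_sub Y) (rat_sub T)"
    and nz: "t \<in> T" "g (f t) \<noteq> 0"
  shows "rat_sub T \<cong> rat_sub Y"
proof -
  obtain r where r: "\<And>t. t \<in> T \<Longrightarrow> f t = r * t" using hom_rat_sub_is_scaling[OF T f] by blast
  obtain s where s: "\<And>y. y \<in> Y \<Longrightarrow> g y = s * y" using hom_rat_sub_is_scaling[OF Y g] by blast
  have fT: "f t \<in> Y" if "t \<in> T" for t using hom_in_carrier[OF f] that by simp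
  have gY: "g y \<in> T" if "y \<in> Y" for y using hom_in_carrier[OF g] that by simp
  have "r \<noteq> 0" "s \<noteq> 0" using nz fT r s by fastforce+
  define H where "H = (\<lambda>t. r * t) ` T"
  have H: "subgroup H rat_group" unfolding H_def
    by (rule subgroup_rat_groupI)
      (auto simp: image_iff intro: bexI[OF _ rat_sub_zero[OF T]] bexI[OF _ rat_sub_add[OF T]]
        bexI[OF _ rat_sub_minus[OF T]] simp flip: distrib_left)
  have HY: "H \<subseteq> Y" unfolding H_def using r fT by force
  obtain c e where ce: "e > 0" "r * s = of_int c / of_int e"
    using quotient_of_denom_pos' quotient_of_div surjective_pairing by metis
  have c: "c \<noteq> 0" using ce \<open>r \<noteq> 0\<close> \<open>s \<noteq> 0\<close> by auto
  have "of_nat (nat \<bar>c\<bar>) * y \<in> H" if y: "y \<in> Y" for y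
  proof -
    have "of_int c * y = of_int e * (r * s) * y" using ce by simp
    also have "\<dots> = r * (of_int e * (s * y))" by (simp only: mult.assoc mult.commute mult.left_commute)
    also have "\<dots> \<in> H" unfolding H_def
      using rat_sub_of_int_mult[OF T gY[OF y]] s[OF y] by auto
    finally have "of_int (sgn c) * (of_int c * y) \<in> H" by (rule rat_sub_of_int_mult[OF H])
    moreover have "of_int (sgn c) * (of_int c * y) = of_nat (nat \<bar>c\<bar>) * y"
      by (simp add: sgn_if)
    ultimately show ?thesis by simp
  qed
  then obtain d where d: "d > 0" "H = (\<lambda>t. of_nat d * t) ` Y"
    using finite_exponent_subgroup_is_multiple[OF Y H HY, of "nat \<bar>c\<bar>"] c by auto
  have "rat_sub T \<cong> rat_sub H" using \<open>r \<noteq> 0\<close> H_def by (rule scaling_iso)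
  moreover have "rat_sub Y \<cong> rat_sub H" using d by (intro scaling_iso[of "of_nat d"]) auto
  ultimately show ?thesis
    using iso_trans group.iso_sym comm_group.axioms(2)[OF comm_group_rat_sub[OF Y]] by metis
qed

section \<open>Direct decompositions and rank-one retracts\<close>

lemma hom_subgroup_carrier_iff:
  "h \<in> hom A (G\<lparr>carrier := B\<rparr>) \<longleftrightarrow>
    (\<forall>x\<in>carrier A. h x \<in> B) \<and> (\<forall>x\<in>carrier A. \<forall>y\<in>carrier A. h (x \<otimes>\<^bsub>A\<^esub> y) = h x \<otimes>\<^bsub>G\<^esub> h y)"
  by (auto simp: hom_def)

context comm_group
begin

lemma subgroup_comm_group: assumes "subgroup A G" shows "comm_group (G\<lparr>carrier := A\<rparr>)"
proof -
  interpret A: group "G\<lparr>carrier := A\<rparr>" by (rule subgroup_imp_group[OF assms])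
  show ?thesis
    using subgroup.mem_carrier[OF assms] by unfold_locales (auto intro: m_comm)
qed

lemma hom_rat_finprod:
  assumes h: "h \<in> hom G (rat_sub Y)" and f: "f \<in> I \<rightarrow> carrier G"
  shows "h (finprod G f I) = (\<Sum>i\<in>I. h (f i))"
proof -
  have one: "h \<one> = 0" using hom_mult[OF h, of \<one> \<one>] by simp
  show ?thesis
  proof (cases "finite I")
    case True
    then show ?thesis using f
      by (induction I rule: finite_induct) (auto simp: one hom_mult[OF h])
  qed (simp add: one)
qed

lemma hom_rat_one: assumes h: "h \<in> hom G (rat_sub Y)" shows "h \<one> = 0"
  using hom_mult[OF h, of \<one> \<one>] by simp

lemma hom_rat_inv: assumes h: "h \<in> hom G (rat_sub Y)" and x: "x \<in> carrier G" shows "h (inv x) = - h x"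
  using hom_mult[OF h, of "inv x" x] hom_rat_one[OF h] x by simp

lemma direct_decomposition_unique:
  assumes d: "direct_decomposition G A B"
    and ab: "a \<in> A" "b \<in> B" "a' \<in> A" "b' \<in> B" "a \<otimes> b = a' \<otimes> b'"
  shows "a = a' \<and> b = b'"
proof -
  have A: "subgroup A G" and B: "subgroup B G" and AB: "A \<inter> B \<subseteq> {\<one>}"
    using d unfolding direct_decomposition_def by auto
  interpret group_disjoint_sum G A B
    by (intro group_disjoint_sum.intro A B is_group)
  show ?thesis using cancel AB ab by blast
qed

lemma direct_decomposition_projection:
  assumes d: "direct_decomposition G A B"
  shows "\<exists>\<pi> \<in> hom G (G\<lparr>carrier := A\<rparr>). (\<forall>a\<in>A. \<pi> a = a) \<and> (\<forall>g\<in>carrier G. \<pi> g = \<one> \<longleftrightarrow> g \<in> B)"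
proof -
  have A: "subgroup A G" and B: "subgroup B G" and AB: "A <#> B = carrier G"
    using d unfolding direct_decomposition_def by auto
  note carr = subgroup.mem_carrier[OF A] subgroup.mem_carrier[OF B]
  define \<pi> where "\<pi> g = (SOME a. a \<in> A \<and> (\<exists>b\<in>B. g = a \<otimes> b))" for g
  have ex: "\<exists>a\<in>A. \<exists>b\<in>B. g = a \<otimes> b" if "g \<in> carrier G" for g
    using that AB unfolding set_mult_def by blast
  have \<pi>: "\<pi> (a \<otimes> b) = a" if ab: "a \<in> A" "b \<in> B" for a b
    unfolding \<pi>_def
  proof (rule some_equality)
    fix a' assume "a' \<in> A \<and> (\<exists>b'\<in>B. a \<otimes> b = a' \<otimes> b')"
    then show "a' = a" using direct_decomposition_unique[OF d ab] by blast
  qed (use ab in blast)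
  have "\<pi> \<in> hom G (G\<lparr>carrier := A\<rparr>)"
    unfolding hom_subgroup_carrier_iff
  proof (intro conjI ballI)
    fix g assume "g \<in> carrier G"
    then show "\<pi> g \<in> A" using ex \<pi> by metis
  next
    fix g g' assume "g \<in> carrier G" "g' \<in> carrier G"
    then obtain a b a' b' where ab: "a \<in> A" "b \<in> B" "a' \<in> A" "b' \<in> B" "g = a \<otimes> b" "g' = a' \<otimes> b'"
      using ex by metis
    then have "g \<otimes> g' = (a \<otimes> a') \<otimes> (b \<otimes> b')" using carr by (simp add: m_ac)
    then show "\<pi> (g \<otimes> g') = \<pi> g \<otimes> \<pi> g'"
      using ab \<pi> subgroup.m_closed[OF A] subgroup.m_closed[OF B] by simp
  qed
  moreover have "\<pi> a = a" if "a \<in> A" for a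
    using \<pi>[OF that subgroup.one_closed[OF B]] carr that by simp
  moreover have "\<pi> g = \<one> \<longleftrightarrow> g \<in> B" if g: "g \<in> carrier G" for g
  proof -
    obtain a b where ab: "a \<in> A" "b \<in> B" "g = a \<otimes> b" using ex g by blast
    have "g \<in> B" if "a = \<one>" using ab carr that by simp
    moreover have "\<pi> g = \<one>" if "g \<in> B"
      using \<pi>[OF subgroup.one_closed[OF A] that] carr that by simp
    moreover have "\<pi> g = a" using \<pi> ab by simp
    ultimately show ?thesis by blast
  qed
  ultimately show ?thesis by blast
qed

lemma direct_decomposition_DirProd_iso:
  assumes d: "direct_decomposition G A B" and K: "K \<cong> G\<lparr>carrier := A\<rparr>"
  shows "G\<lparr>carrier := B\<rparr> \<times>\<times> K \<cong> G"
proof -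
  have A: "subgroup A G" and B: "subgroup B G" and AB: "A <#> B = carrier G"
    using d unfolding direct_decomposition_def by auto
  note carr = subgroup.mem_carrier[OF A] subgroup.mem_carrier[OF B]
  obtain \<phi> where \<phi>: "\<phi> \<in> hom K (G\<lparr>carrier := A\<rparr>)" "bij_betw \<phi> (carrier K) A"
    using K unfolding is_iso_def iso_def by auto
  have \<phi>A: "\<phi> k \<in> A" if "k \<in> carrier K" for k using hom_in_carrier[OF \<phi>(1) that] by simp
  have \<phi>m: "\<phi> (k \<otimes>\<^bsub>K\<^esub> l) = \<phi> k \<otimes> \<phi> l" if "k \<in> carrier K" "l \<in> carrier K" for k l
    using hom_mult[OF \<phi>(1) that] by simp
  let ?f = "\<lambda>(b, k). \<phi> k \<otimes> b"
  have "?f \<in> hom (G\<lparr>carrier := B\<rparr> \<times>\<times> K) G"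
    using carr \<phi>A \<phi>m by (auto simp: hom_def m_ac)
  moreover have "inj_on ?f (B \<times> carrier K)"
  proof (rule inj_onI; clarify)
    fix b k b' k' assume *: "b \<in> B" "k \<in> carrier K" "b' \<in> B" "k' \<in> carrier K"
      and "\<phi> k \<otimes> b = \<phi> k' \<otimes> b'"
    then have "\<phi> k = \<phi> k' \<and> b = b'" using direct_decomposition_unique[OF d] \<phi>A by blast
    then show "b = b' \<and> k = k'"
      using * bij_betw_imp_inj_on[OF \<phi>(2)] by (simp add: inj_on_eq_iff)
  qed
  moreover have "?f ` (B \<times> carrier K) = carrier G"
  proof -
    have "?f ` (B \<times> carrier K) = {a \<otimes> b | a b. a \<in> \<phi> ` carrier K \<and> b \<in> B}" by auto
    moreover have "\<phi> ` carrier K = A" using \<phi>(2) by (simp add: bij_betw_def)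
    moreover have "{a \<otimes> b | a b. a \<in> A \<and> b \<in> B} = A <#> B" by (auto simp: set_mult_def)
    ultimately show ?thesis using AB by simp
  qed
  ultimately have "?f \<in> iso (G\<lparr>carrier := B\<rparr> \<times>\<times> K) G"
    by (simp add: iso_def bij_betw_def)
  then show ?thesis by (rule is_isoI)
qed

text \<open>
  The image of \<open>f\<close> is a rank-one summand with complement the kernel of \<open>g\<close>. Together with its converse
  below this replaces the set-theoretic definition of being clipped by a statement about
  homomorphisms.
\<close>

lemma retract_imp_not_clipped:
  assumes T: "rat_type T" and f: "f \<in> hom (rat_sub T) G" and g: "g \<in> hom G (rat_sub T)"
    and gf: "\<And>t. t \<in> T \<Longrightarrow> g (f t) = t"
  shows "\<not> clipped G"
proof -
  have sT: "subgroup T rat_group" using T by (simp add: rat_type_def)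
  interpret T: comm_group "rat_sub T" by (rule comm_group_rat_sub[OF sT])
  interpret f: group_hom "rat_sub T" G f by unfold_locales (rule f)
  interpret g: group_hom G "rat_sub T" g by unfold_locales (rule g)
  have fT: "f t \<in> carrier G" if "t \<in> T" for t using f.hom_closed that by simp
  have gG: "g x \<in> T" if "x \<in> carrier G" for x using g.hom_closed that by simp
  have B: "subgroup (f ` T) G" using f.img_is_subgroup by simp
  have C: "subgroup (kernel G (rat_sub T) g) G" by (rule g.subgroup_kernel)
  have ker: "x \<in> kernel G (rat_sub T) g \<longleftrightarrow> x \<in> carrier G \<and> g x = 0" for x
    by (simp add: kernel_def)
  have "f ` T \<inter> kernel G (rat_sub T) g \<subseteq> {\<one>}"
    using gf f.hom_one by (auto simp: ker)
  moreover have "\<one> \<in> f ` T \<inter> kernel G (rat_sub T) g"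
    using subgroup.one_closed[OF B] subgroup.one_closed[OF C] by blast
  moreover have "f ` T <#> kernel G (rat_sub T) g = carrier G"
  proof (intro equalityI subsetI)
    fix x assume x: "x \<in> carrier G"
    have y: "f (g x) \<in> carrier G" using x fT gG by simp
    have "g (inv (f (g x)) \<otimes> x) = 0"
      using hom_mult[OF g, of "inv (f (g x))" x] hom_rat_inv[OF g y] x y gf[OF gG[OF x]] by simp
    then have "inv (f (g x)) \<otimes> x \<in> kernel G (rat_sub T) g" using x y by (simp add: ker)
    moreover have "x = f (g x) \<otimes> (inv (f (g x)) \<otimes> x)" using x y by (simp flip: m_assoc)
    ultimately show "x \<in> f ` T <#> kernel G (rat_sub T) g"
      unfolding set_mult_def using gG[OF x] by blast
  qed (auto simp: set_mult_def ker fT)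
  ultimately have "direct_decomposition G (f ` T) (kernel G (rat_sub T) g)"
    unfolding direct_decomposition_def using B C by blast
  moreover have "rank_one (G\<lparr>carrier := f ` T\<rparr>)"
  proof -
    have "inj_on f T" using gf by (metis inj_onI)
    then have "f \<in> iso (rat_sub T) (G\<lparr>carrier := f ` T\<rparr>)"
      using f by (auto simp: iso_def bij_betw_def hom_def)
    then have "G\<lparr>carrier := f ` T\<rparr> \<cong> rat_sub T" using T.iso_sym is_isoI by blast
    then show ?thesis
      unfolding rank_one_def using T subgroup_imp_group[OF B] by (auto simp: rat_type_def)
  qed
  ultimately show ?thesis unfolding clipped_def by blast
qed

lemma not_clipped_imp_retract:
  assumes "\<not> clipped G"
  shows "\<exists>T. \<exists>f\<in>hom (rat_sub T) G. \<exists>g\<in>hom G (rat_sub T). rat_type T \<and> (\<forall>t\<in>T. g (f t) = t)"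
proof -
  obtain B C where d: "direct_decomposition G B C" and "rank_one (G\<lparr>carrier := B\<rparr>)"
    using assms unfolding clipped_def by blast
  then obtain T \<phi> where T: "rat_type T" and \<phi>: "\<phi> \<in> iso (G\<lparr>carrier := B\<rparr>) (rat_sub T)"
    unfolding rank_one_def rat_type_def is_iso_def by auto
  have B: "subgroup B G" using d unfolding direct_decomposition_def by auto
  interpret B: group "G\<lparr>carrier := B\<rparr>" by (rule subgroup_imp_group[OF B])
  obtain \<pi> where \<pi>: "\<pi> \<in> hom G (G\<lparr>carrier := B\<rparr>)" "\<forall>b\<in>B. \<pi> b = b"
    using direct_decomposition_projection[OF d] by blast
  let ?f = "inv_into B \<phi>"
  have f: "?f \<in> iso (rat_sub T) (G\<lparr>carrier := B\<rparr>)" using B.iso_set_sym[OF \<phi>] by simp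
  have "?f \<in> hom (rat_sub T) G"
    using f subgroup.subset[OF B] by (auto simp: iso_def hom_def)
  moreover have "\<phi> \<circ> \<pi> \<in> hom G (rat_sub T)"
    using \<phi> by (intro Group.hom_compose[OF \<pi>(1)]) (auto simp: iso_def)
  moreover have "\<phi> (\<pi> (?f t)) = t" if "t \<in> T" for t
  proof -
    have "t \<in> \<phi> ` B" using \<phi> that by (auto simp: iso_def bij_betw_def)
    then show ?thesis using \<pi>(2) by (simp add: inv_into_into f_inv_into_f)
  qed
  ultimately show ?thesis using T by (intro exI[of _ T] bexI) auto
qed

end

section \<open>Coordinates on a completely decomposable summand\<close>

text \<open>
  A frame is a direct sum decomposition \<open>H 0 \<oplus> \<dots> \<oplus> H (n - 1) \<oplus> B\<close> of \<open>G\<close> seen through homomorphisms: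
  \<open>a i\<close> embeds the subgroup \<open>H i\<close> of the rationals, \<open>p i\<close> reads off the coordinate, and the complement
  \<open>B\<close> is recovered as the joint kernel of the \<open>p i\<close>. Coordinates are plain rational numbers, so
  two frames of one group can be compared by linear algebra.
\<close>

locale rational_frame = comm_group G for G (structure) +
  fixes n :: nat and H :: "nat \<Rightarrow> rat set" and a :: "nat \<Rightarrow> rat \<Rightarrow> 'a" and p :: "nat \<Rightarrow> 'a \<Rightarrow> rat"
  assumes H_rat_type: "i < n \<Longrightarrow> rat_type (H i)"
    and a_hom: "i < n \<Longrightarrow> a i \<in> hom (rat_sub (H i)) G"
    and p_hom: "i < n \<Longrightarrow> p i \<in> hom G (rat_sub (H i))"
    and p_a: "i < n \<Longrightarrow> k < n \<Longrightarrow> t \<in> H k \<Longrightarrow> p i (a k t) = (if i = k then t else 0)"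
begin

lemma H_subgroup: "i < n \<Longrightarrow> subgroup (H i) rat_group"
  using H_rat_type by (simp add: rat_type_def)

lemma a_closed: "i < n \<Longrightarrow> t \<in> H i \<Longrightarrow> a i t \<in> carrier G"
  using hom_in_carrier[OF a_hom] by simp

lemma p_closed: "i < n \<Longrightarrow> g \<in> carrier G \<Longrightarrow> p i g \<in> H i"
  using hom_in_carrier[OF p_hom] by simp

lemma a_add: "i < n \<Longrightarrow> s \<in> H i \<Longrightarrow> t \<in> H i \<Longrightarrow> a i (s + t) = a i s \<otimes> a i t"
  using hom_mult[OF a_hom] by fastforce

lemma p_mult: "i < n \<Longrightarrow> g \<in> carrier G \<Longrightarrow> h \<in> carrier G \<Longrightarrow> p i (g \<otimes> h) = p i g + p i h"
  using hom_mult[OF p_hom] by fastforce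

lemma a_zero: assumes "i < n" shows "a i 0 = \<one>"
  using hom_one[OF a_hom[OF assms] comm_group.axioms(2)[OF comm_group_rat_sub[OF H_subgroup[OF assms]]]] by simp

definition combine :: "(nat \<Rightarrow> rat) \<Rightarrow> 'a" where
  "combine t = (\<Otimes>i\<in>{..<n}. a i (t i))"

definition part :: "'a \<Rightarrow> 'a" where
  "part g = combine (\<lambda>i. p i g)"

definition joint_kernel :: "'a set" where
  "joint_kernel = {g \<in> carrier G. \<forall>i<n. p i g = 0}"

definition rest :: "'a \<Rightarrow> 'a" where
  "rest g = g \<otimes> inv part g"

lemma combine_closed: "(\<And>i. i < n \<Longrightarrow> t i \<in> H i) \<Longrightarrow> combine t \<in> carrier G"
  unfolding combine_def by (auto intro!: finprod_closed a_closed)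

lemma p_combine:
  assumes "\<And>i. i < n \<Longrightarrow> t i \<in> H i" "i < n"
  shows "p i (combine t) = t i"
proof -
  have "p i (combine t) = (\<Sum>k<n. p i (a k (t k)))"
    unfolding combine_def using assms by (intro hom_rat_finprod[OF p_hom]) (auto intro: a_closed)
  also have "\<dots> = (\<Sum>k<n. if k = i then t i else 0)"
    using assms p_a by (intro sum.cong) auto
  finally show ?thesis using assms by simp
qed

lemma combine_cong: "(\<And>i. i < n \<Longrightarrow> s i = t i) \<Longrightarrow> (\<And>i. i < n \<Longrightarrow> t i \<in> H i) \<Longrightarrow> combine s = combine t"
  unfolding combine_def by (intro finprod_cong) (auto simp: simp_implies_def intro: a_closed)

lemma combine_add:
  assumes "\<And>i. i < n \<Longrightarrow> s i \<in> H i" "\<And>i. i < n \<Longrightarrow> t i \<in> H i"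
  shows "combine (\<lambda>i. s i + t i) = combine s \<otimes> combine t"
proof -
  have "combine (\<lambda>i. s i + t i) = (\<Otimes>i\<in>{..<n}. a i (s i) \<otimes> a i (t i))"
    unfolding combine_def using assms
    by (intro finprod_cong) (auto simp: simp_implies_def a_add intro!: a_closed m_closed rat_sub_add[OF H_subgroup])
  also have "\<dots> = combine s \<otimes> combine t"
    unfolding combine_def using assms by (intro finprod_multf) (auto intro!: a_closed)
  finally show ?thesis .
qed

lemma part_closed: "g \<in> carrier G \<Longrightarrow> part g \<in> carrier G"
  unfolding part_def by (intro combine_closed p_closed)

lemma p_part: "g \<in> carrier G \<Longrightarrow> i < n \<Longrightarrow> p i (part g) = p i g"
  unfolding part_def by (intro p_combine p_closed)

lemma part_combine: "(\<And>i. i < n \<Longrightarrow> t i \<in> H i) \<Longrightarrow> part (combine t) = combine t"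
  unfolding part_def by (intro combine_cong p_combine)

lemma part_hom: "part \<in> hom G G"
proof (rule homI)
  fix g h assume gh: "g \<in> carrier G" "h \<in> carrier G"
  have "part (g \<otimes> h) = combine (\<lambda>i. p i g + p i h)"
    unfolding part_def using gh by (intro combine_cong) (auto simp: p_mult intro!: rat_sub_add[OF H_subgroup] p_closed)
  then show "part (g \<otimes> h) = part g \<otimes> part h"
    using gh unfolding part_def by (simp add: combine_add p_closed)
qed (rule part_closed)

lemma rest_closed: "g \<in> carrier G \<Longrightarrow> rest g \<in> carrier G"
  unfolding rest_def by (simp add: part_closed)

lemma rest_hom: "rest \<in> hom G G"
proof (rule homI)
  fix g h assume gh: "g \<in> carrier G" "h \<in> carrier G"
  show "rest (g \<otimes> h) = rest g \<otimes> rest h"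
    unfolding rest_def hom_mult[OF part_hom gh] using gh part_closed by (simp add: inv_mult m_ac)
qed (rule rest_closed)

lemma part_rest: "g \<in> carrier G \<Longrightarrow> part g \<otimes> rest g = g"
  unfolding rest_def by (simp add: part_closed m_lcomm[of "part g" g])

lemma rest_in_kernel: "g \<in> carrier G \<Longrightarrow> rest g \<in> joint_kernel"
  unfolding joint_kernel_def
  using rest_closed hom_rat_inv[OF p_hom] p_part part_closed
  by (auto simp: rest_def p_mult)

lemma part_kernel: assumes "g \<in> joint_kernel" shows "part g = \<one>"
proof -
  have "part g = (\<Otimes>i\<in>{..<n}. \<one>)"
    unfolding part_def combine_def using assms
    by (intro finprod_cong) (auto simp: simp_implies_def joint_kernel_def a_zero)
  then show ?thesis by simp
qed

lemma subgroup_joint_kernel: "subgroup joint_kernel G"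
  unfolding joint_kernel_def
  by (rule subgroup.intro) (auto simp: p_mult hom_rat_one[OF p_hom] hom_rat_inv[OF p_hom])

lemma subgroup_range_part: "subgroup (part ` carrier G) G"
proof -
  interpret part: group_hom G G part by unfold_locales (rule part_hom)
  show ?thesis by (rule part.img_is_subgroup)
qed

lemma direct_decomposition_frame: "direct_decomposition G (part ` carrier G) joint_kernel"
  unfolding direct_decomposition_def
proof (intro conjI subgroup_joint_kernel subgroup_range_part)
  show "part ` carrier G <#> joint_kernel = carrier G"
  proof (intro equalityI subsetI)
    fix x assume x: "x \<in> carrier G"
    then show "x \<in> part ` carrier G <#> joint_kernel"
      unfolding set_mult_def using part_rest[OF x] rest_in_kernel[OF x] by force
  qed (auto simp: set_mult_def joint_kernel_def part_closed)
  have "x = \<one>" if x: "x \<in> part ` carrier G \<inter> joint_kernel" for x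
  proof -
    obtain g where g: "g \<in> carrier G" "x = part g" using x by blast
    then have "part x = x" by (metis part_combine part_def p_closed)
    then show ?thesis using part_kernel x by simp
  qed
  then show "part ` carrier G \<inter> joint_kernel = {\<one>}"
    using subgroup.one_closed[OF subgroup_joint_kernel] subgroup.one_closed[OF subgroup_range_part]
    by blast
qed

lemma sum_group_iso: "sum_group {..<n} (\<lambda>i. rat_sub (H i)) \<cong> G\<lparr>carrier := part ` carrier G\<rparr>"
proof -
  let ?S = "sum_group {..<n} (\<lambda>i. rat_sub (H i))"
  have carr: "carrier ?S = (\<Pi>\<^sub>E i\<in>{..<n}. H i)"
    by (subst carrier_sum_group) (auto intro: comm_group.axioms(2)[OF comm_group_rat_sub] H_subgroup)
  then have in_H: "x i \<in> H i" if "x \<in> carrier ?S" "i < n" for x i using that by auto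
  have "combine (x \<otimes>\<^bsub>?S\<^esub> y) = combine x \<otimes> combine y" if "x \<in> carrier ?S" "y \<in> carrier ?S" for x y
  proof -
    have "combine (x \<otimes>\<^bsub>?S\<^esub> y) = combine (\<lambda>i. x i + y i)"
      using in_H that by (intro combine_cong) (auto intro!: rat_sub_add[OF H_subgroup])
    then show ?thesis using combine_add[of x y] in_H that by simp
  qed
  moreover have "inj_on combine (carrier ?S)"
  proof (rule inj_onI)
    fix x y assume xy: "x \<in> carrier ?S" "y \<in> carrier ?S" "combine x = combine y"
    then have "x i = y i" if "i < n" for i using p_combine[of _ i] in_H that by metis
    then show "x = y" using xy(1,2) unfolding carr by (auto intro: PiE_ext)
  qed
  moreover have "combine ` carrier ?S = part ` carrier G"
  proof (intro equalityI subsetI)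
    fix g assume "g \<in> combine ` carrier ?S"
    then obtain x where "x \<in> carrier ?S" "g = combine x" by blast
    then show "g \<in> part ` carrier G" using part_combine combine_closed in_H by (metis image_eqI)
  next
    fix g assume "g \<in> part ` carrier G"
    then obtain h where h: "h \<in> carrier G" "g = part h" by blast
    have "part h = combine (\<lambda>i\<in>{..<n}. p i h)"
      unfolding part_def using h by (intro combine_cong) (auto simp: p_closed)
    moreover have "(\<lambda>i\<in>{..<n}. p i h) \<in> carrier ?S" unfolding carr using h by (auto simp: p_closed)
    ultimately show "g \<in> combine ` carrier ?S" using h by blast
  qed
  ultimately have "combine \<in> iso ?S (G\<lparr>carrier := part ` carrier G\<rparr>)"
    unfolding iso_def hom_subgroup_carrier_iff bij_betw_def mem_Collect_eq
    by (simp del: mult_sum_group) blast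
  then show ?thesis by (rule is_isoI)
qed

end

text \<open>
  The summands in the definition are arbitrary group structures on the type of rationals; here they
  become genuine subgroups with the usual addition.
\<close>

lemma completely_decomposable_iff_rat_sub:
  "completely_decomposable A \<longleftrightarrow>
    (\<exists>(n::nat) H. (\<forall>i<n. rat_type (H i)) \<and> A \<cong> sum_group {..<n} (\<lambda>i. rat_sub (H i)))"
proof
  assume "completely_decomposable A"
  then obtain n :: nat and X :: "nat \<Rightarrow> rat monoid" where X: "\<And>i. i < n \<Longrightarrow> rank_one (X i)" "A \<cong> sum_group {..<n} X"
    unfolding completely_decomposable_def by blast
  have "\<exists>T. i < n \<longrightarrow> rat_type T \<and> X i \<cong> rat_sub T" for i
    using X(1)[of i] unfolding rank_one_def rat_type_def by blast
  then obtain H where H: "\<And>i. i < n \<Longrightarrow> rat_type (H i) \<and> X i \<cong> rat_sub (H i)"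
    by metis
  have "sum_group {..<n} X \<cong> sum_group {..<n} (\<lambda>i. rat_sub (H i))"
  proof (rule iso_sum_groupI)
    fix i assume "i \<in> {..<n}"
    then have i: "i < n" by simp
    show "X i \<cong> rat_sub (H i)" using H[OF i] by simp
    show "group (X i)" using X(1)[OF i] unfolding rank_one_def by simp
    show "group (rat_sub (H i))"
      using H[OF i] comm_group_rat_sub comm_group.axioms(2) unfolding rat_type_def by blast
  qed
  then show "\<exists>(n::nat) H. (\<forall>i<n. rat_type (H i)) \<and> A \<cong> sum_group {..<n} (\<lambda>i. rat_sub (H i))"
    using X(2) H iso_trans by blast
next
  assume "\<exists>(n::nat) H. (\<forall>i<n. rat_type (H i)) \<and> A \<cong> sum_group {..<n} (\<lambda>i. rat_sub (H i))"
  then obtain n :: nat and H where H: "\<And>i. i < n \<Longrightarrow> rat_type (H i)" "A \<cong> sum_group {..<n} (\<lambda>i. rat_sub (H i))"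
    by blast
  have "rank_one (rat_sub T)" if "rat_type T" for T
    using that comm_group.axioms(2)[OF comm_group_rat_sub] iso_refl[of "rat_sub T"]
    unfolding rank_one_def rat_type_def by blast
  then show "completely_decomposable A"
    unfolding completely_decomposable_def using H by (intro exI conjI allI impI) auto
qed

text \<open>
  The coordinates are those of the isomorphism with the sum, taken after projecting to \<open>A\<close> along \<open>B\<close>.
  They all vanish exactly where that projection does, which is on \<open>B\<close>.
\<close>

lemma (in comm_group) frame_of_direct_decomposition:
  assumes d: "direct_decomposition G A B" and A: "completely_decomposable (G\<lparr>carrier := A\<rparr>)"
  shows "\<exists>n H a p. rational_frame G n H a p \<and> rational_frame.joint_kernel G n p = B \<and>
     sum_group {..<n} (\<lambda>i. rat_sub (H i)) \<cong> G\<lparr>carrier := A\<rparr>"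
proof -
  have sA: "subgroup A G" and sB: "subgroup B G"
    using d unfolding direct_decomposition_def by auto
  interpret A: group "G\<lparr>carrier := A\<rparr>" by (rule subgroup_imp_group[OF sA])
  obtain n :: nat and H where H: "\<And>i. i < n \<Longrightarrow> rat_type (H i)"
      "G\<lparr>carrier := A\<rparr> \<cong> sum_group {..<n} (\<lambda>i. rat_sub (H i))"
    using A unfolding completely_decomposable_iff_rat_sub by blast
  let ?S = "sum_group {..<n} (\<lambda>i. rat_sub (H i))"
  have H_subgroup: "subgroup (H i) rat_group" if "i < n" for i using H that by (simp add: rat_type_def)
  have grp: "group (rat_sub (H i))" if "i \<in> {..<n}" for i
    using comm_group.axioms(2)[OF comm_group_rat_sub] H_subgroup that by simp
  have carr: "carrier ?S = (\<Pi>\<^sub>E i\<in>{..<n}. H i)"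
    by (subst carrier_sum_group) (auto intro: grp)
  interpret S: group ?S by (rule sum_group[OF grp])
  obtain \<phi> where \<phi>: "\<phi> \<in> iso (G\<lparr>carrier := A\<rparr>) ?S" using H(2) unfolding is_iso_def by blast
  define \<psi> where "\<psi> = inv_into A \<phi>"
  have \<psi>: "\<psi> \<in> iso ?S (G\<lparr>carrier := A\<rparr>)" unfolding \<psi>_def using A.iso_set_sym[OF \<phi>] by simp
  have \<phi>bij: "bij_betw \<phi> A (carrier ?S)" and \<phi>hom: "\<phi> \<in> hom (G\<lparr>carrier := A\<rparr>) ?S"
    using \<phi> by (auto simp: iso_def)
  have \<phi>\<psi>: "\<phi> (\<psi> x) = x" if "x \<in> carrier ?S" for x
    unfolding \<psi>_def using \<phi>bij that by (auto simp: bij_betw_def f_inv_into_f)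
  have \<psi>hom: "\<psi> \<in> hom ?S (G\<lparr>carrier := A\<rparr>)" using \<psi> by (simp add: iso_def)
  have \<psi>A: "\<psi> x \<in> A" if "x \<in> carrier ?S" for x
    using hom_in_carrier[OF \<psi>hom that] by simp
  obtain \<pi> where \<pi>: "\<pi> \<in> hom G (G\<lparr>carrier := A\<rparr>)" "\<forall>a\<in>A. \<pi> a = a" "\<forall>g\<in>carrier G. \<pi> g = \<one> \<longleftrightarrow> g \<in> B"
    using direct_decomposition_projection[OF d] by blast
  have \<pi>A: "\<pi> g \<in> A" if "g \<in> carrier G" for g using hom_in_carrier[OF \<pi>(1) that] by simp
  define e where "e k t = (\<lambda>i\<in>{..<n}. if i = k then t else (0::rat))" for k t
  define a where "a k t = \<psi> (e k t)" for k t
  define p where "p i g = \<phi> (\<pi> g) i" for i g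
  have e: "e k t \<in> carrier ?S" if "k < n" "t \<in> H k" for k t
    unfolding carr e_def using that rat_sub_zero[OF H_subgroup] by auto
  have frame: "rational_frame G n H a p"
  proof (intro rational_frame.intro comm_group_axioms rational_frame_axioms.intro)
    fix i assume i: "i < n"
    show "rat_type (H i)" by (rule H(1)[OF i])
    show "a i \<in> hom (rat_sub (H i)) G"
    proof (rule homI)
      fix s t assume st: "s \<in> carrier (rat_sub (H i))" "t \<in> carrier (rat_sub (H i))"
      have "e i (s + t) = e i s \<otimes>\<^bsub>?S\<^esub> e i t" by (auto simp: e_def)
      then show "a i (s \<otimes>\<^bsub>rat_sub (H i)\<^esub> t) = a i s \<otimes> a i t"
        unfolding a_def using hom_mult[OF \<psi>hom, of "e i s" "e i t"] e[OF i] st by simp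
    qed (simp add: a_def \<psi>A e[OF i] subgroup.mem_carrier[OF sA])
    show "p i \<in> hom G (rat_sub (H i))"
    proof (rule homI)
      fix g assume "g \<in> carrier G"
      then have "\<phi> (\<pi> g) \<in> carrier ?S" using \<phi>bij \<pi>A by (auto simp: bij_betw_def)
      then show "p i g \<in> carrier (rat_sub (H i))" unfolding p_def carr using i by auto
    next
      fix g h assume gh: "g \<in> carrier G" "h \<in> carrier G"
      then have "\<phi> (\<pi> (g \<otimes> h)) = \<phi> (\<pi> g) \<otimes>\<^bsub>?S\<^esub> \<phi> (\<pi> h)"
        using hom_mult[OF \<pi>(1) gh] hom_mult[OF \<phi>hom] \<pi>A by simp
      then show "p i (g \<otimes> h) = p i g \<otimes>\<^bsub>rat_sub (H i)\<^esub> p i h" unfolding p_def using i by simp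
    qed
    fix k t assume k: "k < n" "t \<in> H k"
    have "p i (a k t) = e k t i"
      unfolding p_def a_def using \<pi>(2) \<psi>A e[OF k] \<phi>\<psi> by simp
    then show "p i (a k t) = (if i = k then t else 0)" unfolding e_def using i by simp
  qed
  interpret F: rational_frame G n H a p by (rule frame)
  have "F.joint_kernel = B"
  proof -
    have "(\<forall>i<n. p i g = 0) \<longleftrightarrow> g \<in> B" if g: "g \<in> carrier G" for g
    proof -
      have c: "\<phi> (\<pi> g) \<in> carrier ?S" using \<phi>bij \<pi>A[OF g] by (auto simp: bij_betw_def)
      have "(\<forall>i<n. p i g = 0) \<longleftrightarrow> \<phi> (\<pi> g) = \<one>\<^bsub>?S\<^esub>"
      proof
        assume "\<forall>i<n. p i g = 0"
        then show "\<phi> (\<pi> g) = \<one>\<^bsub>?S\<^esub>"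
          using c unfolding carr p_def one_sum_group
          by (intro PiE_ext[where k = "{..<n}" and s = H]) (auto simp: rat_sub_zero[OF H_subgroup])
      qed (auto simp: p_def)
      also have "\<dots> \<longleftrightarrow> \<phi> (\<pi> g) = \<phi> \<one>"
        using hom_one[OF \<phi>hom A.is_group S.is_group] by simp
      also have "\<dots> \<longleftrightarrow> \<pi> g = \<one>"
        using \<phi>bij \<pi>A[OF g] subgroup.one_closed[OF sA] by (auto simp: bij_betw_def inj_on_eq_iff)
      finally show ?thesis using \<pi>(3) g by simp
    qed
    then show ?thesis unfolding F.joint_kernel_def using subgroup.subset[OF sB] by auto
  qed
  moreover have "?S \<cong> G\<lparr>carrier := A\<rparr>" using \<psi> is_isoI by blast
  ultimately show ?thesis using frame by blast
qed

section \<open>Uniqueness of the completely decomposable part\<close>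

lemma group_rat_sub: "rat_type T \<Longrightarrow> group (rat_sub T)"
  using comm_group_rat_sub comm_group.axioms(2) unfolding rat_type_def by blast

text \<open>
  The heart of the uniqueness statement. Suppose that the first frame had more summands isomorphic
  to \<open>T\<close>, indexed by \<open>I\<close>, than the second one, where they are indexed by \<open>J\<close>. Embed \<open>T\<close> into \<open>G\<close> by
  \<open>x\<close>, sending \<open>t\<close> to the element with coordinates \<open>v i * t\<close> along \<open>I\<close> (each \<open>H i\<close> identified with \<open>T\<close>), for an integer vector \<open>v\<close> with
  \<open>\<Sum> u i * v i = 1\<close>. The map \<open>\<alpha>\<close> with coefficients \<open>u i\<close> is a left inverse of \<open>x\<close>. As \<open>I\<close> is larger than
  \<open>J\<close>, the vector \<open>v\<close> can be chosen such that \<open>x\<close> has zero coordinates along \<open>J\<close>. Its coordinates along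
  the remaining summands of the second frame, which are not isomorphic to \<open>T\<close>, are annihilated by \<open>\<alpha>\<close>
  because a composite \<open>T \<rightarrow> K j \<rightarrow> T\<close> can only be nonzero if \<open>T\<close> and \<open>K j\<close> are isomorphic. So \<open>\<alpha>\<close>
  sees of \<open>x t\<close> only the component in the joint kernel of the second frame, and \<open>T\<close> is a retract of that
  clipped group, which is impossible.
\<close>

lemma card_iso_type_le:
  fixes G (structure)
  assumes F: "rational_frame G n H a p" and F': "rational_frame G m K b q"
    and clipped: "clipped (G\<lparr>carrier := rational_frame.joint_kernel G m q\<rparr>)"
    and T: "rat_type T"
  shows "card {i. i < n \<and> rat_sub (H i) \<cong> rat_sub T} \<le> card {j. j < m \<and> rat_sub (K j) \<cong> rat_sub T}"
proof (rule ccontr)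
  interpret F: rational_frame G n H a p by (rule F)
  interpret F': rational_frame G m K b q by (rule F')
  define I where "I = {i. i < n \<and> rat_sub (H i) \<cong> rat_sub T}"
  define J where "J = {j. j < m \<and> rat_sub (K j) \<cong> rat_sub T}"
  have I: "i < n" if "i \<in> I" for i using that by (simp add: I_def)
  assume "\<not> ?thesis"
  then have less: "card J < card I" unfolding I_def J_def by simp
  have fin: "finite I" "finite J" unfolding I_def J_def by auto
  have sT: "subgroup T rat_group" using T by (simp add: rat_type_def)
  interpret T: comm_group "rat_sub T" by (rule comm_group_rat_sub[OF sT])
  obtain t0 where t0: "t0 \<in> T" "t0 \<noteq> 0" using T rat_sub_zero[OF sT] unfolding rat_type_def by blast
  have "\<exists>\<theta>. i \<in> I \<longrightarrow> \<theta> \<in> iso (rat_sub T) (rat_sub (H i))" for i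
    using group.iso_sym[OF group_rat_sub[OF F.H_rat_type]] unfolding I_def is_iso_def by blast
  then obtain \<theta> where \<theta>: "\<And>i. i \<in> I \<Longrightarrow> \<theta> i \<in> iso (rat_sub T) (rat_sub (H i))" by metis
  define \<eta> where "\<eta> i = inv_into T (\<theta> i)" for i
  have \<theta>hom: "\<theta> i \<in> hom (rat_sub T) (rat_sub (H i))" if "i \<in> I" for i
    using \<theta>[OF that] by (simp add: iso_def)
  have \<theta>H: "\<theta> i t \<in> H i" if "i \<in> I" "t \<in> T" for i t
    using hom_in_carrier[OF \<theta>hom] that by simp
  have \<eta>hom: "\<eta> i \<in> hom (rat_sub (H i)) (rat_sub T)" if "i \<in> I" for i
    using T.iso_set_sym[OF \<theta>[OF that]] by (simp add: iso_def \<eta>_def)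
  have \<eta>\<theta>: "\<eta> i (\<theta> i t) = t" if "i \<in> I" "t \<in> T" for i t
    using \<theta>[OF that(1)] that(2) by (simp add: iso_def \<eta>_def bij_betw_def)
  have \<eta>T: "\<eta> i s \<in> T" if "i \<in> I" "s \<in> H i" for i s
    using hom_in_carrier[OF \<eta>hom] that by simp
  obtain u v :: "nat \<Rightarrow> int" where uv: "(\<Sum>i\<in>I. u i * v i) = 1"
    and v: "\<And>j. j \<in> J \<Longrightarrow> (\<Sum>i\<in>I. of_int (v i) * q j (a i (\<theta> i t0))) = 0"
    using homogeneous_system_unimodular_solution[OF fin(2,1) less, of "\<lambda>j i. q j (a i (\<theta> i t0))"]
    by blast
  define x where "x t = (\<Otimes>i\<in>I. a i (\<theta> i (of_int (v i) * t)))" for t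
  have vT: "of_int (v i) * t \<in> T" if "t \<in> T" for i t
    by (rule rat_sub_of_int_mult[OF sT that])
  have xi: "a i (\<theta> i (of_int (v i) * t)) \<in> carrier G" if "i \<in> I" "t \<in> T" for i t
    using that by (intro F.a_closed I \<theta>H vT)
  have x_closed: "x t \<in> carrier G" if "t \<in> T" for t
    unfolding x_def using xi that by (intro F.finprod_closed) auto
  have x_hom: "x \<in> hom (rat_sub T) G"
  proof (rule homI)
    fix s t assume "s \<in> carrier (rat_sub T)" "t \<in> carrier (rat_sub T)"
    then have st: "s \<in> T" "t \<in> T" by auto
    have add: "a i (\<theta> i (of_int (v i) * (s + t))) =
      a i (\<theta> i (of_int (v i) * s)) \<otimes> a i (\<theta> i (of_int (v i) * t))" if i: "i \<in> I" for i
    proof -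
      have "\<theta> i (of_int (v i) * (s + t)) = \<theta> i (of_int (v i) * s) + \<theta> i (of_int (v i) * t)"
        using hom_mult[OF \<theta>hom[OF i]] vT st by (simp add: distrib_left)
      then show ?thesis using F.a_add I i \<theta>H vT st by simp
    qed
    have "x (s + t) = (\<Otimes>i\<in>I. a i (\<theta> i (of_int (v i) * s)) \<otimes> a i (\<theta> i (of_int (v i) * t)))"
      unfolding x_def using xi st by (intro F.finprod_cong) (auto simp: simp_implies_def add)
    also have "\<dots> = x s \<otimes> x t"
      unfolding x_def using xi st by (intro F.finprod_multf) auto
    finally show "x (s \<otimes>\<^bsub>rat_sub T\<^esub> t) = x s \<otimes> x t" by simp
  qed (simp add: x_closed)
  have qx_hom: "q j \<circ> x \<in> hom (rat_sub T) (rat_sub (K j))" if "j < m" for j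
    by (rule Group.hom_compose[OF x_hom F'.p_hom[OF that]])
  have qx0: "q j (x t) = 0" if j: "j \<in> J" and t: "t \<in> T" for j t
  proof -
    have jm: "j < m" using j by (simp add: J_def)
    have "q j (x t0) = (\<Sum>i\<in>I. q j (a i (\<theta> i (of_int (v i) * t0))))"
      unfolding x_def using xi t0 by (intro F.hom_rat_finprod[OF F'.p_hom[OF jm]]) auto
    also have "\<dots> = (\<Sum>i\<in>I. of_int (v i) * q j (a i (\<theta> i t0)))"
    proof (rule sum.cong)
      fix i assume i: "i \<in> I"
      have "q j \<circ> a i \<circ> \<theta> i \<in> hom (rat_sub T) (rat_sub (K j))"
        by (rule Group.hom_compose[OF \<theta>hom[OF i] Group.hom_compose[OF F.a_hom[OF I[OF i]] F'.p_hom[OF jm]]])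
      from hom_rat_sub_of_int_mult[OF sT this t0(1), of "v i"]
      show "q j (a i (\<theta> i (of_int (v i) * t0))) = of_int (v i) * q j (a i (\<theta> i t0))" by simp
    qed simp
    also have "\<dots> = 0" by (rule v[OF j])
    finally have "q j (x t0) = 0" .
    moreover obtain r where r: "\<forall>t\<in>T. q j (x t) = r * t"
      using hom_rat_sub_is_scaling[OF sT qx_hom[OF jm]] by auto
    \<comment> \<open>One nonzero zero of a scaling suffices, so the linear system only has to involve \<open>t0\<close>.\<close>
    ultimately have "r = 0" using t0 by auto
    then show ?thesis using r t by simp
  qed
  define \<alpha> where "\<alpha> g = (\<Sum>i\<in>I. of_int (u i) * \<eta> i (p i g))" for g
  have \<alpha>T: "\<alpha> g \<in> T" if "g \<in> carrier G" for g
    unfolding \<alpha>_def using that fin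
    by (intro rat_sub_sum[OF sT] rat_sub_of_int_mult[OF sT] \<eta>T F.p_closed I)
  have \<alpha>hom: "\<alpha> \<in> hom G (rat_sub T)"
  proof (rule homI)
    fix g h assume gh: "g \<in> carrier G" "h \<in> carrier G"
    have "\<eta> i (p i (g \<otimes> h)) = \<eta> i (p i g) + \<eta> i (p i h)" if i: "i \<in> I" for i
      using hom_mult[OF \<eta>hom[OF i], of "p i g" "p i h"] F.p_mult F.p_closed I i gh by simp
    then show "\<alpha> (g \<otimes> h) = \<alpha> g \<otimes>\<^bsub>rat_sub T\<^esub> \<alpha> h"
      unfolding \<alpha>_def by (simp add: distrib_left sum.distrib)
  qed (simp add: \<alpha>T)
  have \<alpha>x: "\<alpha> (x t) = t" if t: "t \<in> T" for t
  proof -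
    have "p i (x t) = \<theta> i (of_int (v i) * t)" if i: "i \<in> I" for i
    proof -
      have "p i (x t) = (\<Sum>k\<in>I. p i (a k (\<theta> k (of_int (v k) * t))))"
        unfolding x_def using xi t by (intro F.hom_rat_finprod[OF F.p_hom[OF I[OF i]]]) auto
      also have "\<dots> = (\<Sum>k\<in>I. if k = i then \<theta> i (of_int (v i) * t) else 0)"
        using F.p_a[OF I[OF i] I] \<theta>H vT t by (intro sum.cong) auto
      finally show ?thesis using i fin by simp
    qed
    then have "\<alpha> (x t) = (\<Sum>i\<in>I. of_int (u i) * (of_int (v i) * t))"
      unfolding \<alpha>_def using \<eta>\<theta> vT[OF t] by (intro sum.cong) auto
    also have "\<dots> = of_int (\<Sum>i\<in>I. u i * v i) * t"
      by (simp add: sum_distrib_right mult.assoc)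
    finally show ?thesis using uv by simp
  qed
  have \<alpha>part: "\<alpha> (F'.part (x t)) = 0" if t: "t \<in> T" for t
  proof -
    have qK: "q j (x t) \<in> K j" if "j < m" for j using F'.p_closed[OF that x_closed[OF t]] .
    have "\<alpha> (F'.part (x t)) = (\<Sum>j<m. \<alpha> (b j (q j (x t))))"
      unfolding F'.part_def F'.combine_def
      using F'.a_closed qK by (intro F.hom_rat_finprod[OF \<alpha>hom]) auto
    also have "\<dots> = 0"
    proof (intro sum.neutral ballI)
      fix j assume "j \<in> {..<m}"
      then have j: "j < m" by simp
      show "\<alpha> (b j (q j (x t))) = 0"
      proof (cases "j \<in> J")
        case True
        then show ?thesis using qx0 t F'.a_zero[OF j] F.hom_rat_one[OF \<alpha>hom] by simp
      next
        case False
        show ?thesis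
        proof (rule ccontr)
          assume "\<alpha> (b j (q j (x t))) \<noteq> 0"
          then have "rat_sub T \<cong> rat_sub (K j)"
            using mutual_maps_imp_iso[OF sT F'.H_subgroup[OF j] qx_hom[OF j]
                Group.hom_compose[OF F'.a_hom[OF j] \<alpha>hom] t] by simp
          then have "rat_sub (K j) \<cong> rat_sub T" by (rule T.iso_sym)
          then show False using False j by (simp add: J_def)
        qed
      qed
    qed
    finally show ?thesis .
  qed
  have \<alpha>rest: "\<alpha> (F'.rest (x t)) = t" if t: "t \<in> T" for t
  proof -
    have "\<alpha> (x t) = \<alpha> (F'.part (x t)) + \<alpha> (F'.rest (x t))"
      using hom_mult[OF \<alpha>hom F'.part_closed F'.rest_closed] F'.part_rest x_closed[OF t] by fastforce
    then show ?thesis using \<alpha>x[OF t] \<alpha>part[OF t] by simp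
  qed
  let ?B = "G\<lparr>carrier := F'.joint_kernel\<rparr>"
  interpret B: comm_group ?B
    by (rule F.subgroup_comm_group[OF F'.subgroup_joint_kernel])
  have "F'.rest \<circ> x \<in> hom (rat_sub T) ?B"
    using F'.rest_in_kernel x_closed Group.hom_compose[OF x_hom F'.rest_hom]
    by (auto simp: hom_def)
  moreover have "\<alpha> \<in> hom ?B (rat_sub T)"
    using \<alpha>hom subgroup.mem_carrier[OF F'.subgroup_joint_kernel] by (auto simp: hom_def)
  ultimately have "\<not> clipped ?B"
    using \<alpha>rest by (intro B.retract_imp_not_clipped[OF T]) auto
  then show False using clipped by blast
qed

lemma fibrewise_bijection:
  assumes fin: "finite A" "finite B" and card: "\<And>c. card {a\<in>A. f a = c} = card {b\<in>B. g b = c}"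
  shows "\<exists>h. bij_betw h A B \<and> (\<forall>a\<in>A. g (h a) = f a)"
proof -
  have "\<exists>h. bij_betw h {a\<in>A. f a = c} {b\<in>B. g b = c}" for c
    using finite_same_card_bij[OF _ _ card[of c]] fin by simp
  then obtain h where h: "\<And>c. bij_betw (h c) {a\<in>A. f a = c} {b\<in>B. g b = c}" by metis
  have in_B: "h (f a) a \<in> B" "g (h (f a) a) = f a" if "a \<in> A" for a
    using bij_betwE[OF h[of "f a"]] that by auto
  have "bij_betw (\<lambda>a. h (f a) a) A B"
  proof (rule bij_betwI')
    fix x y assume xy: "x \<in> A" "y \<in> A"
    show "(h (f x) x = h (f y) y) = (x = y)"
    proof
      assume eq: "h (f x) x = h (f y) y"
      then have "f x = f y" using in_B xy by metis
      then show "x = y" using eq bij_betw_imp_inj_on[OF h[of "f x"]] xy by (simp add: inj_on_def)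
    qed simp
  next
    fix b assume "b \<in> B"
    then have "b \<in> h (g b) ` {a\<in>A. f a = g b}" using h[of "g b"] by (auto simp: bij_betw_def)
    then obtain a where "a \<in> A" "f a = g b" "b = h (g b) a" by blast
    then show "\<exists>a\<in>A. b = h (f a) a" by metis
  qed (use in_B in auto)
  then show ?thesis using in_B by blast
qed

lemma sum_group_reindex_iso:
  assumes h: "bij_betw h I J" and fin: "finite I" and grp: "\<And>j. j \<in> J \<Longrightarrow> group (X j)"
  shows "sum_group J X \<cong> sum_group I (\<lambda>i. X (h i))"
proof -
  have hJ: "h i \<in> J" if "i \<in> I" for i using bij_betwE[OF h] that by blast
  have finJ: "finite J" using h fin bij_betw_finite by blast
  have carrJ: "carrier (sum_group J X) = (\<Pi>\<^sub>E j\<in>J. carrier (X j))"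
    using finJ by (subst carrier_sum_group) (auto intro: grp)
  have carrI: "carrier (sum_group I (\<lambda>i. X (h i))) = (\<Pi>\<^sub>E i\<in>I. carrier (X (h i)))"
    using fin by (subst carrier_sum_group) (auto intro: grp hJ)
  let ?f = "\<lambda>y. \<lambda>i\<in>I. y (h i)"
  have "?f \<in> hom (sum_group J X) (sum_group I (\<lambda>i. X (h i)))"
    by (rule homI) (auto simp: carrJ carrI hJ intro!: restrict_ext)
  moreover have "bij_betw ?f (\<Pi>\<^sub>E j\<in>J. carrier (X j)) (\<Pi>\<^sub>E i\<in>I. carrier (X (h i)))"
  proof (rule bij_betw_byWitness[where f' = "\<lambda>x. \<lambda>j\<in>J. x (inv_into I h j)"])
    have inv: "inv_into I h j \<in> I" "h (inv_into I h j) = j" if "j \<in> J" for j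
      using h that by (auto simp: bij_betw_def inv_into_into f_inv_into_f)
    have inv': "inv_into I h (h i) = i" if "i \<in> I" for i
      using h that by (auto simp: bij_betw_def)
    show "\<forall>y\<in>\<Pi>\<^sub>E j\<in>J. carrier (X j). (\<lambda>j\<in>J. ?f y (inv_into I h j)) = y"
      using inv by (auto intro!: PiE_ext[where k = J and s = "\<lambda>j. carrier (X j)"] simp: PiE_iff)
    show "\<forall>x\<in>\<Pi>\<^sub>E i\<in>I. carrier (X (h i)). ?f (\<lambda>j\<in>J. x (inv_into I h j)) = x"
      using inv' hJ by (auto intro!: PiE_ext[where k = I and s = "\<lambda>i. carrier (X (h i))"] simp: PiE_iff)
    show "?f ` (\<Pi>\<^sub>E j\<in>J. carrier (X j)) \<subseteq> (\<Pi>\<^sub>E i\<in>I. carrier (X (h i)))"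
      using hJ by auto
    show "(\<lambda>x. \<lambda>j\<in>J. x (inv_into I h j)) ` (\<Pi>\<^sub>E i\<in>I. carrier (X (h i))) \<subseteq> (\<Pi>\<^sub>E j\<in>J. carrier (X j))"
    proof (clarify, rule PiE_I)
      fix x j assume x: "x \<in> (\<Pi>\<^sub>E i\<in>I. carrier (X (h i)))" and j: "j \<in> J"
      show "(\<lambda>j\<in>J. x (inv_into I h j)) j \<in> carrier (X j)"
        using PiE_mem[OF x inv(1)[OF j]] inv(2)[OF j] j by simp
    qed simp
  qed
  ultimately have "?f \<in> iso (sum_group J X) (sum_group I (\<lambda>i. X (h i)))"
    by (simp add: iso_def carrJ carrI)
  then show ?thesis by (rule is_isoI)
qed

text \<open>
  Equally many summands in every isomorphism class give a bijection of the index sets that respects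
  isomorphism of the summands.
\<close>

lemma sum_group_iso_of_clipped_complements:
  assumes F: "rational_frame G n H a p" and F': "rational_frame G m K b q"
    and clipped: "clipped (G\<lparr>carrier := rational_frame.joint_kernel G n p\<rparr>)"
    and clipped': "clipped (G\<lparr>carrier := rational_frame.joint_kernel G m q\<rparr>)"
  shows "sum_group {..<n} (\<lambda>i. rat_sub (H i)) \<cong> sum_group {..<m} (\<lambda>j. rat_sub (K j))"
proof -
  interpret F: rational_frame G n H a p by (rule F)
  interpret F': rational_frame G m K b q by (rule F')
  define cls where "cls T = {S. rat_type S \<and> rat_sub S \<cong> rat_sub T}" for T
  have cls: "cls S = cls T \<longleftrightarrow> rat_sub S \<cong> rat_sub T" if "rat_type S" "rat_type T" for S T
    using that iso_refl[of "rat_sub S"] iso_trans group.iso_sym[OF group_rat_sub]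
    unfolding cls_def by blast
  have count: "card {i\<in>{..<n}. cls (H i) = cls T} = card {j\<in>{..<m}. cls (K j) = cls T}"
    if T: "rat_type T" for T
  proof -
    have "{i\<in>{..<n}. cls (H i) = cls T} = {i. i < n \<and> rat_sub (H i) \<cong> rat_sub T}"
      "{j\<in>{..<m}. cls (K j) = cls T} = {j. j < m \<and> rat_sub (K j) \<cong> rat_sub T}"
      using cls F.H_rat_type F'.H_rat_type T by auto
    then show ?thesis
      using card_iso_type_le[OF F F' clipped' T] card_iso_type_le[OF F' F clipped T] by simp
  qed
  have "card {i\<in>{..<n}. cls (H i) = c} = card {j\<in>{..<m}. cls (K j) = c}" for c
  proof (cases "\<exists>T. rat_type T \<and> cls T = c")
    case True
    then show ?thesis using count by blast
  next
    case False
    then have "{i\<in>{..<n}. cls (H i) = c} = {}" "{j\<in>{..<m}. cls (K j) = c} = {}"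
      using F.H_rat_type F'.H_rat_type by auto
    then show ?thesis by (simp only:)
  qed
  from fibrewise_bijection[OF _ _ this]
  obtain h where h: "bij_betw h {..<n} {..<m}" "\<And>i. i < n \<Longrightarrow> cls (K (h i)) = cls (H i)" by auto
  have hm: "h i < m" if "i < n" for i using bij_betwE[OF h(1)] that by auto
  have "sum_group {..<m} (\<lambda>j. rat_sub (K j)) \<cong> sum_group {..<n} (\<lambda>i. rat_sub (K (h i)))"
    using h(1) by (rule sum_group_reindex_iso) (auto intro: group_rat_sub F'.H_rat_type)
  also have "sum_group {..<n} (\<lambda>i. rat_sub (K (h i))) \<cong> sum_group {..<n} (\<lambda>i. rat_sub (H i))"
    using h(2) cls hm F.H_rat_type F'.H_rat_type by (intro iso_sum_groupI) (auto intro: group_rat_sub)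
  finally (iso_trans) have "sum_group {..<m} (\<lambda>j. rat_sub (K j)) \<cong> sum_group {..<n} (\<lambda>i. rat_sub (H i))" .
  then show ?thesis
    by (rule group.iso_sym[rotated]) (auto intro!: sum_group group_rat_sub F'.H_rat_type)
qed

section \<open>The rank bounds the number of coordinates\<close>

lemma comm_group_rat_group: "comm_group rat_group"
proof -
  have "rat_sub UNIV = rat_group" by (simp add: rat_group_def)
  moreover have "subgroup UNIV rat_group" by (rule subgroup_rat_groupI) auto
  ultimately show ?thesis using comm_group_rat_sub by metis
qed

context comm_group
begin

text \<open>
  Spanning is used through subspaces: a property that cuts out a subspace holds for all tensors once it
  holds for the generators.
\<close>

lemma finite_rank_iff_submodule:
  "finite_rank G \<longleftrightarrow> (\<exists>S. finite S \<and> S \<subseteq> carrier (rat_tensor G) \<and>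
     (\<forall>N. submodule class_ring N (rat_tensor G) \<longrightarrow> S \<subseteq> N \<longrightarrow> carrier (rat_tensor G) \<subseteq> N))"
proof -
  interpret V: vectorspace class_ring "rat_tensor G" by (rule vectorspace_rat_tensor)
  have "V.gen_set S \<longleftrightarrow>
      (\<forall>N. submodule class_ring N (rat_tensor G) \<longrightarrow> S \<subseteq> N \<longrightarrow> carrier (rat_tensor G) \<subseteq> N)"
    if S: "S \<subseteq> carrier (rat_tensor G)" for S
  proof
    assume "V.gen_set S"
    then show "\<forall>N. submodule class_ring N (rat_tensor G) \<longrightarrow> S \<subseteq> N \<longrightarrow> carrier (rat_tensor G) \<subseteq> N"
      using V.span_is_subset by metis
  next
    assume "\<forall>N. submodule class_ring N (rat_tensor G) \<longrightarrow> S \<subseteq> N \<longrightarrow> carrier (rat_tensor G) \<subseteq> N"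
    then have "carrier (rat_tensor G) \<subseteq> V.span S"
      using V.span_is_submodule[OF S] V.in_own_span[OF S] by metis
    then show "V.gen_set S" using V.span_is_subset2[OF S] by (intro equalityI)
  qed
  then show ?thesis unfolding finite_rank_def V.fin_dim_def by metis
qed

lemma tensor_free_diff_closed:
  assumes "c \<in> carrier (tensor_free G)" "d \<in> carrier (tensor_free G)"
  shows "c - d \<in> carrier (tensor_free G)"
  using assms keys_diff[of c d] by (simp only: carrier_free_Abelian_group_iff) blast

lemma zero_rat_tensor: "\<zero>\<^bsub>rat_tensor G\<^esub> = tensor_null G #>\<^bsub>tensor_free G\<^esub> 0"
  unfolding rat_tensor_def
  using group.coset_join2[OF group_free_Abelian_group _ subgroup_tensor_null, of 0]
    subgroup.one_closed[OF subgroup_tensor_null] by (simp add: FactGroup_def)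

text \<open>
  \<open>L\<close> is the rational functional on the tensor product that sends \<open>q \<otimes> g\<close> to \<open>q * \<phi> g\<close>, expressed on
  representatives: additive and homogeneous on the free group, and zero on the relations.
\<close>

definition extends_to_tensor :: "('a \<Rightarrow> rat) \<Rightarrow> ((rat \<times> 'a \<Rightarrow>\<^sub>0 int) \<Rightarrow> rat) \<Rightarrow> bool" where
  "extends_to_tensor \<phi> L \<longleftrightarrow>
     (\<forall>x\<in>carrier (tensor_free G). \<forall>y\<in>carrier (tensor_free G). L (x + y) = L x + L y) \<and>
     (\<forall>q. \<forall>g\<in>carrier G. L (frag_of (q, g)) = q * \<phi> g) \<and> (\<forall>x\<in>tensor_null G. L x = 0) \<and>
     (\<forall>r. \<forall>x\<in>carrier (tensor_free G). L (tensor_scale r x) = r * L x)"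

lemma hom_to_rat_extends_to_tensor:
  assumes \<phi>: "\<phi> \<in> hom G rat_group"
  shows "\<exists>L. extends_to_tensor \<phi> L"
proof -
  interpret Q: comm_group rat_group by (rule comm_group_rat_group)
  obtain L where L: "L \<in> hom (tensor_free G) rat_group"
    and frag: "\<And>x. x \<in> UNIV \<times> carrier G \<Longrightarrow> L (frag_of x) = (case x of (q, g) \<Rightarrow> q * \<phi> g)"
    using Q.free_Abelian_group_universal[of "\<lambda>(q, g). q * \<phi> g" "UNIV \<times> carrier G"] by auto
  have frag': "L (frag_of (q, g)) = q * \<phi> g" if "g \<in> carrier G" for q g
    using frag[of "(q, g)"] that by simp
  have add: "L (x + y) = L x + L y" if "x \<in> carrier (tensor_free G)" "y \<in> carrier (tensor_free G)" for x y
    using hom_mult[OF L that] by (simp del: carrier_free_Abelian_group_iff)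
  have diff: "L (x - y) = L x - L y" if "x \<in> carrier (tensor_free G)" "y \<in> carrier (tensor_free G)" for x y
    using add[OF tensor_free_diff_closed[OF that] that(2)] by simp
  interpret L: group_hom "tensor_free G" rat_group L
    by (intro group_hom.intro group_hom_axioms.intro L Q.is_group group_free_Abelian_group)
  have frag_closed: "frag_of (q, g) \<in> carrier (tensor_free G)" if "g \<in> carrier G" for q g
    using that by simp
  have "L r = 0" if rel: "r \<in> tensor_relations G" for r
  proof -
    have diff2: "L (frag_of (q, a) - frag_of (s, b) - frag_of (t, c)) = q * \<phi> a - s * \<phi> b - t * \<phi> c"
      if "a \<in> carrier G" "b \<in> carrier G" "c \<in> carrier G" for q s t a b c
      unfolding diff[OF tensor_free_diff_closed[OF frag_closed[OF that(1)] frag_closed[OF that(2)]] frag_closed[OF that(3)]]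
        diff[OF frag_closed[OF that(1)] frag_closed[OF that(2)]] frag'[OF that(1)] frag'[OF that(2)] frag'[OF that(3)]
      by (rule refl)
    consider (left) s q a where "a \<in> carrier G" "r = frag_of (s + q, a) - frag_of (s, a) - frag_of (q, a)"
      | (right) q a b where "a \<in> carrier G" "b \<in> carrier G"
        "r = frag_of (q, a \<otimes> b) - frag_of (q, a) - frag_of (q, b)"
      using rel unfolding tensor_relations_def by blast
    then show ?thesis
    proof cases
      case left
      show ?thesis unfolding left(2) diff2[OF left(1) left(1) left(1)] by (simp add: algebra_simps)
    next
      case right
      show ?thesis
        unfolding right(3) diff2[OF m_closed[OF right(1,2)] right(1,2)]
        using hom_mult[OF \<phi> right(1,2)] by (simp add: algebra_simps)
    qed
  qed
  then have "tensor_relations G \<subseteq> kernel (tensor_free G) rat_group L"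
    using tensor_relations_subset by (auto simp: kernel_def simp del: carrier_free_Abelian_group_iff)
  then have "tensor_null G \<subseteq> kernel (tensor_free G) rat_group L"
    unfolding tensor_null_def
    by (rule group.generate_subgroup_incl[OF group_free_Abelian_group _ L.subgroup_kernel])
  then have null: "L x = 0" if "x \<in> tensor_null G" for x
    using that by (auto simp: kernel_def)
  have scale: "L (tensor_scale r x) = r * L x" if "x \<in> carrier (tensor_free G)" for r x
  proof -
    have "Poly_Mapping.keys x \<subseteq> UNIV \<times> carrier G"
      using that by (simp only: carrier_free_Abelian_group_iff)
    note L_diff = diff
    from \<open>Poly_Mapping.keys x \<subseteq> UNIV \<times> carrier G\<close>
    have "x \<in> carrier (tensor_free G) \<and> L (tensor_scale r x) = r * L x"
    proof (induction x rule: frag_induction)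
      case zero
      then show ?case using L.hom_one by (simp add: tensor_scale_zero)
    next
      case (one x)
      then show ?case
        by (cases x) (simp add: tensor_scale_of frag')
    next
      case (diff a b)
      then have ab: "a \<in> carrier (tensor_free G)" "b \<in> carrier (tensor_free G)"
        and IH: "L (tensor_scale r a) = r * L a" "L (tensor_scale r b) = r * L b" by blast+
      have "L (tensor_scale r (a - b)) = r * L (a - b)"
        unfolding tensor_scale_diff L_diff[OF tensor_scale_closed[OF ab(1)] tensor_scale_closed[OF ab(2)]]
          L_diff[OF ab] IH by (simp add: right_diff_distrib)
      then show ?case using tensor_free_diff_closed[OF ab] by blast
    qed
    then show ?thesis by blast
  qed
  show ?thesis unfolding extends_to_tensor_def using add frag' null scale by blast
qed

text \<open>
  Homomorphisms to the rationals extend to functionals on the tensor product. With more functionals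
  than elements of a spanning set, some nontrivial combination of them vanishes on the spanning set,
  hence everywhere.
\<close>

lemma homs_to_rat_dependent:
  assumes "finite_rank G"
  shows "\<exists>N. \<forall>n>N. \<forall>\<phi> :: nat \<Rightarrow> 'a \<Rightarrow> rat. (\<forall>i<n. \<phi> i \<in> hom G rat_group) \<longrightarrow>
     (\<exists>u. (\<exists>i<n. u i \<noteq> 0) \<and> (\<forall>g\<in>carrier G. (\<Sum>i<n. u i * \<phi> i g) = 0))"
proof -
  obtain S where S: "finite S" "S \<subseteq> carrier (rat_tensor G)"
    and gen: "\<And>N. submodule class_ring N (rat_tensor G) \<Longrightarrow> S \<subseteq> N \<Longrightarrow> carrier (rat_tensor G) \<subseteq> N"
    using assms unfolding finite_rank_iff_submodule by blast
  define coset_of where "coset_of c = tensor_null G #>\<^bsub>tensor_free G\<^esub> c" for c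
  have "\<exists>c. C \<in> S \<longrightarrow> c \<in> carrier (tensor_free G) \<and> C = coset_of c" for C
    using S(2) carrier_rat_tensor_iff unfolding coset_of_def by blast
  then obtain c where c: "\<And>C. C \<in> S \<Longrightarrow> c C \<in> carrier (tensor_free G) \<and> C = coset_of (c C)" by metis
  show ?thesis
  proof (intro exI[of _ "card S"] allI impI)
    fix n and \<phi> :: "nat \<Rightarrow> 'a \<Rightarrow> rat"
    assume n: "card S < n" and \<phi>: "\<forall>i<n. \<phi> i \<in> hom G rat_group"
    have "\<exists>L. i < n \<longrightarrow> extends_to_tensor (\<phi> i) L" for i
      using hom_to_rat_extends_to_tensor \<phi> by metis
    then obtain L where "\<And>i. i < n \<Longrightarrow> extends_to_tensor (\<phi> i) (L i)" by metis
    then have L: "\<And>i x y. i < n \<Longrightarrow> x \<in> carrier (tensor_free G) \<Longrightarrow> y \<in> carrier (tensor_free G) \<Longrightarrow> L i (x + y) = L i x + L i y"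
      "\<And>i q g. i < n \<Longrightarrow> g \<in> carrier G \<Longrightarrow> L i (frag_of (q, g)) = q * \<phi> i g"
      "\<And>i x. i < n \<Longrightarrow> x \<in> tensor_null G \<Longrightarrow> L i x = 0"
      "\<And>i r x. i < n \<Longrightarrow> x \<in> carrier (tensor_free G) \<Longrightarrow> L i (tensor_scale r x) = r * L i x"
      unfolding extends_to_tensor_def by blast+
    have card: "card S < card {..<n}" using n by simp
    obtain u where u: "\<exists>i\<in>{..<n}. u i \<noteq> 0"
      "\<And>C. C \<in> S \<Longrightarrow> (\<Sum>i<n. u i * L i (c C)) = 0"
      using homogeneous_system_nontrivial_solution[OF S(1) finite_lessThan card, of "\<lambda>C i. L i (c C)"]
      by blast
    define M where "M x = (\<Sum>i<n. u i * L i x)" for x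
    have M_add: "M (x + y) = M x + M y" if "x \<in> carrier (tensor_free G)" "y \<in> carrier (tensor_free G)" for x y
      unfolding M_def using L(1) that by (simp add: distrib_left sum.distrib del: carrier_free_Abelian_group_iff)
    have M_null: "M x = 0" if "x \<in> tensor_null G" for x
      unfolding M_def using L(3) that by simp
    have M_scale: "M (tensor_scale r x) = r * M x" if "x \<in> carrier (tensor_free G)" for r x
      unfolding M_def using L(4) that
      by (simp add: sum_distrib_left mult.left_commute del: carrier_free_Abelian_group_iff)
    have null_closed: "x \<in> carrier (tensor_free G)" if "x \<in> tensor_null G" for x
      by (rule subgroup.mem_carrier[OF subgroup_tensor_null that])
    have M_cong: "M x = M y" if xy: "y \<in> carrier (tensor_free G)" "coset_of x = coset_of y" "x \<in> carrier (tensor_free G)" for x y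
    proof -
      have "x \<in> coset_of y"
        using group.rcos_self[OF group_free_Abelian_group xy(3) subgroup_tensor_null] xy(2)
        unfolding coset_of_def by simp
      then obtain h where "h \<in> tensor_null G" "x = h + y"
        unfolding coset_of_def r_coset_def mult_free_Abelian_group by blast
      then show ?thesis using M_add[OF null_closed xy(1)] M_null by simp
    qed
    define N where "N = coset_of ` {x \<in> carrier (tensor_free G). M x = 0}"
    have "submodule class_ring N (rat_tensor G)"
    proof (rule submodule.intro)
      show "module class_ring (rat_tensor G)"
        using vectorspace_rat_tensor by (rule vectorspace.axioms)
      show "N \<subseteq> carrier (rat_tensor G)"
        unfolding N_def coset_of_def by (auto simp: carrier_rat_tensor_iff simp del: carrier_free_Abelian_group_iff)
      show "v \<oplus>\<^bsub>rat_tensor G\<^esub> w \<in> N" if "v \<in> N" "w \<in> N" for v w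
      proof -
        obtain x y where xy: "x \<in> carrier (tensor_free G)" "y \<in> carrier (tensor_free G)"
          "M x = 0" "M y = 0" "v = coset_of x" "w = coset_of y" using \<open>v \<in> N\<close> \<open>w \<in> N\<close> unfolding N_def by blast
        then have "v \<oplus>\<^bsub>rat_tensor G\<^esub> w = coset_of (x + y)" unfolding coset_of_def using add_rat_tensor by blast
        then show ?thesis
          unfolding N_def using xy M_add tensor_free_add_closed by (auto simp del: carrier_free_Abelian_group_iff)
      qed
      have "0 \<in> carrier (tensor_free G)" "M 0 = 0"
        using subgroup.one_closed[OF subgroup_tensor_null] M_null by auto
      moreover have "\<zero>\<^bsub>rat_tensor G\<^esub> = coset_of 0" unfolding coset_of_def by (rule zero_rat_tensor)
      ultimately show "\<zero>\<^bsub>rat_tensor G\<^esub> \<in> N" unfolding N_def by blast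
      show "r \<odot>\<^bsub>rat_tensor G\<^esub> v \<in> N" if "v \<in> N" for r v
      proof -
        obtain x where x: "x \<in> carrier (tensor_free G)" "M x = 0" "v = coset_of x"
          using \<open>v \<in> N\<close> unfolding N_def by blast
        then have "r \<odot>\<^bsub>rat_tensor G\<^esub> v = coset_of (tensor_scale r x)"
          unfolding coset_of_def using smult_rat_tensor by blast
        then show ?thesis
          unfolding N_def using x M_scale tensor_scale_closed by (auto simp del: carrier_free_Abelian_group_iff)
      qed
    qed
    moreover have "S \<subseteq> N"
      unfolding N_def M_def using c u(2) by blast
    ultimately have N: "carrier (rat_tensor G) \<subseteq> N" by (rule gen)
    have "(\<Sum>i<n. u i * \<phi> i g) = 0" if g: "g \<in> carrier G" for g
    proof -
      have fg: "frag_of (1, g) \<in> carrier (tensor_free G)" using g by simp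
      then have "coset_of (frag_of (1, g)) \<in> N"
        using N carrier_rat_tensor_iff unfolding coset_of_def by blast
      then obtain x where "x \<in> carrier (tensor_free G)" "M x = 0" "coset_of (frag_of (1, g)) = coset_of x"
        unfolding N_def by blast
      then have "M (frag_of (1, g)) = 0" using M_cong[OF _ _ fg] by metis
      then show ?thesis unfolding M_def using L(2) g by simp
    qed
    then show "\<exists>u. (\<exists>i<n. u i \<noteq> 0) \<and> (\<forall>g\<in>carrier G. (\<Sum>i<n. u i * \<phi> i g) = 0)"
      using u(1) by blast
  qed
qed

text \<open>
  The coordinates of a frame are linearly independent, as they are dual to nonzero elements of \<open>G\<close>.
\<close>

lemma rational_frame_length_bounded:
  assumes "finite_rank G"
  shows "\<exists>N. \<forall>n H a p. rational_frame G n H a p \<longrightarrow> n \<le> N"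
proof -
  obtain N where N: "\<forall>n>N. \<forall>\<phi> :: nat \<Rightarrow> 'a \<Rightarrow> rat. (\<forall>i<n. \<phi> i \<in> hom G rat_group) \<longrightarrow>
     (\<exists>u. (\<exists>i<n. u i \<noteq> 0) \<and> (\<forall>g\<in>carrier G. (\<Sum>i<n. u i * \<phi> i g) = 0))"
    using homs_to_rat_dependent[OF assms] by (rule exE)
  have "n \<le> N" if "rational_frame G n H a p" for n H a p
  proof (rule ccontr)
    interpret rational_frame G n H a p by (rule that)
    assume "\<not> n \<le> N"
    then have "N < n" by simp
    moreover have "\<forall>i<n. p i \<in> hom G rat_group"
      using p_hom by (auto simp: hom_def)
    ultimately have "\<exists>u. (\<exists>i<n. u i \<noteq> 0) \<and> (\<forall>g\<in>carrier G. (\<Sum>k<n. u k * p k g) = 0)"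
      using N by metis
    then obtain u i where i: "i < n" "u i \<noteq> 0"
      and u: "\<And>g. g \<in> carrier G \<Longrightarrow> (\<Sum>k<n. u k * p k g) = 0"
      by metis
    obtain t where t: "t \<in> H i" "t \<noteq> 0"
      using H_rat_type[OF i(1)] rat_sub_zero[OF H_subgroup[OF i(1)]] unfolding rat_type_def by blast
    have "(\<Sum>k<n. u k * p k (a i t)) = (\<Sum>k<n. if k = i then u i * t else 0)"
      using p_a i t by (intro sum.cong) auto
    then show False using u[OF a_closed[OF i(1) t(1)]] i t by simp
  qed
  then show ?thesis by blast
qed

end

lemma (in rational_frame) part_a:
  assumes k: "k < n" and t: "t \<in> H k"
  shows "part (a k t) = a k t"
proof -
  have "part (a k t) = (\<Otimes>i\<in>{..<n}. if k = i then a i t else \<one>)"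
    unfolding part_def combine_def using p_a k t a_zero a_closed
    by (intro finprod_cong) (auto simp: simp_implies_def)
  also have "\<dots> = a k t"
  proof -
    have "(\<Otimes>i\<in>{..<n}. if k = i then a i t else \<one>) = (\<Otimes>i\<in>{..<n}. if k = i then a k t else \<one>)"
      using a_closed k t by (intro finprod_cong) (auto simp: simp_implies_def)
    also have "\<dots> = a k t"
      using finprod_singleton[of k "{..<n}" "\<lambda>_. a k t"] a_closed k t by simp
    finally show ?thesis .
  qed
  finally show ?thesis .
qed

text \<open>
  A rank-one retract of the joint kernel becomes an additional coordinate, after composing its
  retraction with the projection \<open>rest\<close> onto the joint kernel.
\<close>

lemma (in rational_frame) extend_frame:
  assumes "\<not> clipped (G\<lparr>carrier := joint_kernel\<rparr>)"
  shows "\<exists>H a p. rational_frame G (Suc n) H a p"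
proof -
  let ?B = "G\<lparr>carrier := joint_kernel\<rparr>"
  interpret B: comm_group ?B by (rule subgroup_comm_group[OF subgroup_joint_kernel])
  obtain T f g where f: "f \<in> hom (rat_sub T) ?B" and g: "g \<in> hom ?B (rat_sub T)"
    and T: "rat_type T" and gf: "\<forall>t\<in>T. g (f t) = t"
    using B.not_clipped_imp_retract[OF assms] by blast
  have kc: "x \<in> carrier G" if "x \<in> joint_kernel" for x
    by (rule subgroup.mem_carrier[OF subgroup_joint_kernel that])
  have fB: "f t \<in> joint_kernel" if "t \<in> T" for t using hom_in_carrier[OF f] that by simp
  have f': "f \<in> hom (rat_sub T) G" using f kc by (auto simp: hom_def)
  have "rest \<in> hom G ?B" using rest_hom rest_in_kernel by (auto simp: hom_def)
  then have g': "g \<circ> rest \<in> hom G (rat_sub T)" using g by (rule Group.hom_compose)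
  have gf': "g (rest (f t)) = t" if "t \<in> T" for t
    using gf that part_kernel[OF fB] kc[OF fB] by (simp add: rest_def)
  have ga: "g (rest (a k t)) = 0" if "k < n" "t \<in> H k" for k t
    using part_a a_closed that B.hom_rat_one[OF g] by (simp add: rest_def)
  have pf: "p i (f t) = 0" if "i < n" "t \<in> T" for i t
    using fB that unfolding joint_kernel_def by blast
  have "rational_frame G (Suc n) (H(n := T)) (a(n := f)) (p(n := g \<circ> rest))"
  proof (intro rational_frame.intro comm_group_axioms rational_frame_axioms.intro)
    fix i assume i: "i < Suc n"
    show "rat_type ((H(n := T)) i)" using T H_rat_type i by (auto simp: less_Suc_eq)
    show "(a(n := f)) i \<in> hom (rat_sub ((H(n := T)) i)) G" using f' a_hom i by (auto simp: less_Suc_eq)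
    show "(p(n := g \<circ> rest)) i \<in> hom G (rat_sub ((H(n := T)) i))" using g' p_hom i by (auto simp: less_Suc_eq)
    fix k t assume "k < Suc n" "t \<in> (H(n := T)) k"
    then show "(p(n := g \<circ> rest)) i ((a(n := f)) k t) = (if i = k then t else 0)"
      using i gf' ga pf p_a by (auto simp: less_Suc_eq)
  qed
  then show ?thesis by blast
qed

text \<open>
  A frame of maximal length has a clipped joint kernel, since otherwise it could be extended.
\<close>

lemma (in comm_group) decomposable_clipped_decomposition_exists:
  assumes "finite_rank G"
  shows "\<exists>A B. direct_decomposition G A B \<and> completely_decomposable (G\<lparr>carrier := A\<rparr>) \<and>
    clipped (G\<lparr>carrier := B\<rparr>)"
proof -
  define P where "P n \<longleftrightarrow> (\<exists>H a p. rational_frame G n H a p)" for n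
  have "rational_frame G 0 H a p" for H a p
    by (intro rational_frame.intro comm_group_axioms rational_frame_axioms.intro) auto
  then have "P 0" unfolding P_def by blast
  moreover obtain N where "\<And>n. P n \<Longrightarrow> n \<le> N"
    unfolding P_def using rational_frame_length_bounded[OF assms] by blast
  ultimately obtain n where n: "P n" "\<not> P (Suc n)"
    by (metis GreatestI_nat Greatest_le_nat lessI not_less)
  then obtain H a p where "rational_frame G n H a p" unfolding P_def by blast
  then interpret F: rational_frame G n H a p .
  have "clipped (G\<lparr>carrier := F.joint_kernel\<rparr>)"
    using F.extend_frame n(2) unfolding P_def by blast
  moreover have "completely_decomposable (G\<lparr>carrier := F.part ` carrier G\<rparr>)"
  proof -
    have "G\<lparr>carrier := F.part ` carrier G\<rparr> \<cong> sum_group {..<n} (\<lambda>i. rat_sub (H i))"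
      using F.sum_group_iso by (rule group.iso_sym[rotated]) (auto intro!: sum_group group_rat_sub F.H_rat_type)
    then show ?thesis using F.H_rat_type unfolding completely_decomposable_iff_rat_sub by blast
  qed
  ultimately show ?thesis using F.direct_decomposition_frame by blast
qed

section \<open>Finite rank of sums of rank-one groups\<close>

context comm_group
begin

text \<open>
  The pure tensor \<open>q \<otimes> g\<close>.
\<close>

definition tens :: "rat \<Rightarrow> 'a \<Rightarrow> (rat \<times> 'a \<Rightarrow>\<^sub>0 int) set" where
  "tens q g = tensor_null G #>\<^bsub>tensor_free G\<^esub> frag_of (q, g)"

lemma frag_of_closed: "g \<in> carrier G \<Longrightarrow> frag_of (q, g) \<in> carrier (tensor_free G)"
  by simp

lemma tens_closed: "g \<in> carrier G \<Longrightarrow> tens q g \<in> carrier (rat_tensor G)"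
  unfolding tens_def carrier_rat_tensor_iff using frag_of_closed by blast

lemma tens_add_left:
  assumes "g \<in> carrier G"
  shows "tens (p + q) g = tens p g \<oplus>\<^bsub>rat_tensor G\<^esub> tens q g"
proof -
  have "frag_of (p + q, g) - (frag_of (p, g) + frag_of (q, g)) \<in> tensor_null G"
    unfolding tensor_null_def tensor_relations_def diff_diff_eq[symmetric] using assms
    by (intro generate.incl) blast
  then have "tens (p + q) g = tensor_null G #>\<^bsub>tensor_free G\<^esub> (frag_of (p, g) + frag_of (q, g))"
    unfolding tens_def
    by (rule tensor_coset_eqI[OF frag_of_closed[OF assms] tensor_free_add_closed[OF frag_of_closed[OF assms] frag_of_closed[OF assms]]])
  then show ?thesis
    unfolding tens_def using add_rat_tensor[OF frag_of_closed[OF assms] frag_of_closed[OF assms]] by metis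
qed

lemma tens_mult_right:
  assumes "g \<in> carrier G" "h \<in> carrier G"
  shows "tens q (g \<otimes> h) = tens q g \<oplus>\<^bsub>rat_tensor G\<^esub> tens q h"
proof -
  have "frag_of (q, g \<otimes> h) - (frag_of (q, g) + frag_of (q, h)) \<in> tensor_null G"
    unfolding tensor_null_def tensor_relations_def diff_diff_eq[symmetric] using assms
    by (intro generate.incl) blast
  then have "tens q (g \<otimes> h) = tensor_null G #>\<^bsub>tensor_free G\<^esub> (frag_of (q, g) + frag_of (q, h))"
    unfolding tens_def
    by (rule tensor_coset_eqI[OF frag_of_closed[OF m_closed[OF assms]] tensor_free_add_closed[OF frag_of_closed[OF assms(1)] frag_of_closed[OF assms(2)]]])
  then show ?thesis
    unfolding tens_def using add_rat_tensor[OF frag_of_closed[OF assms(1)] frag_of_closed[OF assms(2)]] by metis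
qed

lemma smult_tens:
  assumes "g \<in> carrier G"
  shows "r \<odot>\<^bsub>rat_tensor G\<^esub> tens q g = tens (r * q) g"
  unfolding tens_def smult_rat_tensor[OF frag_of_closed[OF assms]] tensor_scale_of by (rule refl)

lemma tens_zero_left: assumes "g \<in> carrier G" shows "tens 0 g = \<zero>\<^bsub>rat_tensor G\<^esub>"
proof -
  interpret M: abelian_group "rat_tensor G" by (rule abelian_group_rat_tensor)
  show ?thesis
    using tens_add_left[OF assms, of 0 0] tens_closed[OF assms] M.add.r_cancel_one' by simp
qed

lemma tens_one_right: "tens q \<one> = \<zero>\<^bsub>rat_tensor G\<^esub>"
proof -
  interpret M: abelian_group "rat_tensor G" by (rule abelian_group_rat_tensor)
  show ?thesis
    using tens_mult_right[OF one_closed one_closed, of q] tens_closed[OF one_closed, of q]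
      M.add.r_cancel_one' by simp
qed

lemma tens_inv:
  assumes g: "g \<in> carrier G"
  shows "tens q (inv g) = tens (- q) g"
proof -
  interpret M: abelian_group "rat_tensor G" by (rule abelian_group_rat_tensor)
  have "tens q g \<oplus>\<^bsub>rat_tensor G\<^esub> tens q (inv g) = tens q g \<oplus>\<^bsub>rat_tensor G\<^esub> tens (- q) g"
    using tens_mult_right[OF g inv_closed[OF g], of q] tens_add_left[OF g, of q "- q"]
      tens_one_right tens_zero_left[OF g] g by simp
  moreover have "tens q g \<in> carrier (rat_tensor G)" "tens q (inv g) \<in> carrier (rat_tensor G)"
      "tens (- q) g \<in> carrier (rat_tensor G)"
    using g by (simp_all add: tens_closed)
  ultimately show ?thesis
    by (metis M.a_assoc M.l_neg M.l_zero M.a_inv_closed)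
qed

text \<open>
  Moving an integer across the tensor sign; with \<open>q / m\<close> in place of \<open>q\<close> this expresses \<open>q \<otimes> g\<close> through
  the \<open>m\<close>-th power of \<open>g\<close>.
\<close>

lemma tens_of_nat_mult:
  assumes g: "g \<in> carrier G"
  shows "tens (of_nat m * q) g = tens q (g [^] m)"
proof (induction m)
  case 0
  then show ?case by (simp add: tens_zero_left[OF g] tens_one_right)
next
  case (Suc m)
  have "tens (of_nat (Suc m) * q) g = tens (of_nat m * q + q) g"
    by (simp add: algebra_simps)
  also have "\<dots> = tens q (g [^] m) \<oplus>\<^bsub>rat_tensor G\<^esub> tens q g"
    unfolding tens_add_left[OF g] Suc ..
  also have "\<dots> = tens q (g [^] Suc m)"
    unfolding nat_pow_Suc tens_mult_right[OF nat_pow_closed[OF g] g] ..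
  finally show ?case .
qed

lemma submodule_containing_tens:
  assumes N: "submodule class_ring N (rat_tensor G)"
    and tens: "\<And>q g. g \<in> carrier G \<Longrightarrow> tens q g \<in> N"
  shows "carrier (rat_tensor G) \<subseteq> N"
proof -
  interpret M: vectorspace class_ring "rat_tensor G" by (rule vectorspace_rat_tensor)
  interpret N: submodule class_ring N "rat_tensor G" by (rule N)
  define coset_of where "coset_of c = tensor_null G #>\<^bsub>tensor_free G\<^esub> c" for c
  have "c \<in> carrier (tensor_free G) \<and> coset_of c \<in> N" if "Poly_Mapping.keys c \<subseteq> UNIV \<times> carrier G" for c
    using that
  proof (induction c rule: frag_induction)
    case zero
    have "0 \<in> carrier (tensor_free G)" by simp
    moreover have "coset_of 0 = \<zero>\<^bsub>rat_tensor G\<^esub>" unfolding coset_of_def by (rule zero_rat_tensor[symmetric])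
    ultimately show ?case using N.zero_closed by simp
  next
    case (one x)
    then show ?case using tens unfolding coset_of_def tens_def by (cases x) auto
  next
    case (diff b d)
    then have bd: "b \<in> carrier (tensor_free G)" "d \<in> carrier (tensor_free G)" "coset_of b \<in> N" "coset_of d \<in> N"
      by blast+
    have c: "b - d \<in> carrier (tensor_free G)" by (rule tensor_free_diff_closed[OF bd(1,2)])
    have carr: "coset_of (b - d) \<in> carrier (rat_tensor G)" "coset_of d \<in> carrier (rat_tensor G)"
      unfolding coset_of_def carrier_rat_tensor_iff using c bd(2) by blast+
    have "coset_of (b - d) \<oplus>\<^bsub>rat_tensor G\<^esub> coset_of d = coset_of b"
      unfolding coset_of_def add_rat_tensor[OF c bd(2)] by simp
    then have "coset_of (b - d) = coset_of b \<oplus>\<^bsub>rat_tensor G\<^esub> (\<ominus>\<^bsub>rat_tensor G\<^esub> coset_of d)"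
      using carr by (metis M.a_assoc M.a_inv_closed M.r_neg M.r_zero)
    moreover have "\<ominus>\<^bsub>rat_tensor G\<^esub> coset_of d = (\<ominus>\<^bsub>class_ring\<^esub> \<one>\<^bsub>class_ring\<^esub>) \<odot>\<^bsub>rat_tensor G\<^esub> coset_of d"
      using carr M.smult_l_minus[of "\<one>\<^bsub>class_ring\<^esub>" "coset_of d"] M.smult_one by simp
    moreover have "(\<ominus>\<^bsub>class_ring\<^esub> \<one>\<^bsub>class_ring\<^esub>) \<odot>\<^bsub>rat_tensor G\<^esub> coset_of d \<in> N"
      using bd(4) by (intro N.smult_closed) auto
    ultimately have "coset_of (b - d) \<in> N" using N.m_closed[OF bd(3)] by simp
    then show ?case using c by blast
  qed
  then show ?thesis
    unfolding coset_of_def using carrier_rat_tensor_iff by (metis carrier_free_Abelian_group_iff subsetI)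
qed

text \<open>
  A group has finite rank once it is torsion modulo a finitely generated subgroup, because denominators
  are invertible in the tensor product.
\<close>

lemma finite_rankI:
  assumes S: "finite S" "S \<subseteq> carrier G"
    and tors: "\<And>g. g \<in> carrier G \<Longrightarrow> \<exists>m>0::nat. g [^] m \<in> generate G S"
  shows "finite_rank G"
  unfolding finite_rank_iff_submodule
proof (intro exI[of _ "tens 1 ` S"] conjI allI impI)
  show "finite (tens 1 ` S)" using S(1) by simp
  show "tens 1 ` S \<subseteq> carrier (rat_tensor G)" using S(2) tens_closed by blast
  fix N assume N: "submodule class_ring N (rat_tensor G)" and SN: "tens 1 ` S \<subseteq> N"
  interpret M: vectorspace class_ring "rat_tensor G" by (rule vectorspace_rat_tensor)
  interpret N: submodule class_ring N "rat_tensor G" by (rule N)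
  have base: "tens q s \<in> N" if "s \<in> S" for q s
  proof -
    have "q \<odot>\<^bsub>rat_tensor G\<^esub> tens 1 s \<in> N" using SN that by (intro N.smult_closed) auto
    then show ?thesis using smult_tens[of s q 1] S(2) that by auto
  qed
  have gen: "tens q g \<in> N" if "g \<in> generate G S" for q g
    using that
  proof (induction rule: generate.induct)
    case one then show ?case by (simp add: tens_one_right)
  next
    case (incl h) then show ?case by (rule base)
  next
    case (inv h) then show ?case using base tens_inv S(2) by auto
  next
    case (eng h k)
    then show ?case
      using tens_mult_right generate_in_carrier[OF S(2)] N.m_closed by simp
  qed
  have "tens q g \<in> N" if g: "g \<in> carrier G" for q g
  proof -
    obtain m :: nat where m: "m > 0" "g [^] m \<in> generate G S" using tors[OF g] by blast
    have "tens q g = tens (of_nat m * (q / of_nat m)) g" using m by simp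
    also have "\<dots> = tens (q / of_nat m) (g [^] m)" by (rule tens_of_nat_mult[OF g])
    finally show ?thesis using gen[OF m(2)] by simp
  qed
  then show "carrier (rat_tensor G) \<subseteq> N" by (rule submodule_containing_tens[OF N])
qed

end

text \<open>
  Choose a nonzero element in each summand. Every element of a summand has a positive multiple that
  is an integer multiple of the chosen one, and the elements with a positive multiple in a given
  subgroup are closed under sums.
\<close>

lemma (in rational_frame) finite_rank_of_trivial_kernel:
  assumes "joint_kernel = {\<one>}"
  shows "finite_rank G"
proof -
  have "\<exists>s. i < n \<longrightarrow> s \<in> H i \<and> s \<noteq> 0" for i
    using H_rat_type[of i] rat_sub_zero[OF H_subgroup] unfolding rat_type_def by blast
  then obtain s where s: "\<And>i. i < n \<Longrightarrow> s i \<in> H i \<and> s i \<noteq> 0" by metis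
  define S where "S = (\<lambda>i. a i (s i)) ` {..<n}"
  have S: "finite S" "S \<subseteq> carrier G" unfolding S_def using a_closed s by auto
  have sg: "subgroup (generate G S) G" by (rule generate_is_subgroup[OF S(2)])
  define D where "D g \<longleftrightarrow> g \<in> carrier G \<and> (\<exists>m>0::nat. g [^] m \<in> generate G S)" for g
  have pow: "g [^] k \<in> generate G S" if "g \<in> generate G S" for g and k :: nat
    using that subgroup.one_closed[OF sg] subgroup.m_closed[OF sg] by (induction k) auto
  have D_mult: "D (g \<otimes> h)" if gh: "D g" "D h" for g h
  proof -
    obtain k l :: nat where kl: "k > 0" "g [^] k \<in> generate G S" "l > 0" "h [^] l \<in> generate G S"
      and c: "g \<in> carrier G" "h \<in> carrier G" using gh unfolding D_def by blast
    have "(g \<otimes> h) [^] (k * l) = (g [^] k) [^] l \<otimes> (h [^] l) [^] k"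
      using c by (simp add: nat_pow_distrib nat_pow_pow mult.commute)
    also have "\<dots> \<in> generate G S"
      by (rule subgroup.m_closed[OF sg pow[OF kl(2)] pow[OF kl(4)]])
    finally show ?thesis using c kl unfolding D_def by (auto intro!: exI[of _ "k * l"])
  qed
  have a_pow: "a i t [^] m = a i (of_nat m * t)" if i: "i < n" and t: "t \<in> H i" for i t and m :: nat
  proof (induction m)
    case 0 then show ?case using a_zero[OF i] by simp
  next
    case (Suc m)
    have "of_nat m * t \<in> H i" using rat_sub_of_int_mult[OF H_subgroup[OF i] t, of "int m"] by simp
    moreover have "of_nat (Suc m) * t = of_nat m * t + t" by (simp add: algebra_simps)
    ultimately show ?case using a_add[OF i _ t] Suc by simp
  qed
  have D_a: "D (a i t)" if i: "i < n" and t: "t \<in> H i" for i t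
  proof -
    let ?X = "{x \<in> H i. a i x \<in> generate G S}"
    have "subgroup ?X rat_group"
    proof (rule subgroup_rat_groupI)
      show "0 \<in> ?X" using rat_sub_zero[OF H_subgroup[OF i]] a_zero[OF i] subgroup.one_closed[OF sg] by simp
      show "x + y \<in> ?X" if "x \<in> ?X" "y \<in> ?X" for x y
        using that rat_sub_add[OF H_subgroup[OF i]] a_add[OF i] subgroup.m_closed[OF sg] by simp
      show "- x \<in> ?X" if "x \<in> ?X" for x
      proof -
        have x: "x \<in> H i" "- x \<in> H i" using that rat_sub_minus[OF H_subgroup[OF i]] by auto
        have "a i (- x) \<otimes> a i x = \<one>" using a_add[OF i x(2,1)] a_zero[OF i] by simp
        then have "a i (- x) = inv (a i x)" using a_closed i x by (simp add: inv_equality)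
        then show ?thesis using that x subgroup.m_inv_closed[OF sg] by simp
      qed
    qed
    moreover have "s i \<in> ?X"
      using s[OF i] i unfolding S_def by (auto intro!: generate.incl)
    ultimately have k: "of_int k * s i \<in> ?X" for k by (rule rat_sub_of_int_mult)
    obtain c d where cd: "d > 0" "t / s i = of_int c / of_int d"
      using quotient_of_denom_pos' quotient_of_div surjective_pairing by metis
    then have "of_nat (nat d) * t = of_int c * s i" using s[OF i] by (simp add: field_simps)
    then have "a i t [^] nat d \<in> generate G S" using a_pow[OF i t] k by simp
    then show ?thesis unfolding D_def using a_closed i t cd by (auto intro!: exI[of _ "nat d"])
  qed
  have one: "D \<one>" unfolding D_def using subgroup.one_closed[OF sg] by (auto intro!: exI[of _ "1::nat"])
  have "D g" if g: "g \<in> carrier G" for g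
  proof -
    have fin: "D (finprod G f I)" if "finite I" "\<And>i. i \<in> I \<Longrightarrow> D (f i)" for f and I :: "nat set"
      using that
    proof (induction I rule: finite_induct)
      case (insert x I)
      then have "f \<in> I \<rightarrow> carrier G" "f x \<in> carrier G" unfolding D_def by auto
      then show ?case using insert D_mult by simp
    qed (simp add: one)
    have "rest g = \<one>" using rest_in_kernel[OF g] assms by simp
    then have "part g = g" using part_rest[OF g] part_closed[OF g] by simp
    moreover have "D (part g)"
      unfolding part_def combine_def using D_a p_closed g by (intro fin) auto
    ultimately show ?thesis by simp
  qed
  then show ?thesis unfolding D_def by (intro finite_rankI[OF S]) blast
qed

lemma carrier_sum_group_finite:
  assumes "finite I" "\<And>i. i \<in> I \<Longrightarrow> group (X i)"
  shows "carrier (sum_group I X) = (\<Pi>\<^sub>E i\<in>I. carrier (X i))"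
  using assms by (subst carrier_sum_group) auto

text \<open>
  This makes the sum of rank-one groups an admissible witness for near isomorphism.
\<close>

lemma tffr_group_sum_group:
  fixes n :: nat
  assumes H: "\<And>i. i < n \<Longrightarrow> rat_type (H i)"
  shows "tffr_group (sum_group {..<n} (\<lambda>i. rat_sub (H i)))"
proof -
  let ?K = "sum_group {..<n} (\<lambda>i. rat_sub (H i))"
  have grp: "group (rat_sub (H i))" if "i \<in> {..<n}" for i using group_rat_sub H that by simp
  have carr: "carrier ?K = (\<Pi>\<^sub>E i\<in>{..<n}. H i)"
    using carrier_sum_group_finite[OF finite_lessThan, of n "\<lambda>i. rat_sub (H i)"] grp by simp
  interpret K: group ?K by (rule sum_group[OF grp])
  interpret K: comm_group ?K
    by unfold_locales (auto simp: add.commute)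
  have pow: "(x [^]\<^bsub>?K\<^esub> m) i = of_nat m * x i" if "i < n" for x i and m :: nat
    using that by (induction m) (auto simp: algebra_simps)
  have "torsion_free ?K"
    unfolding torsion_free_def
  proof (intro ballI allI impI)
    fix x and m :: nat assume x: "x \<in> carrier ?K" and m: "m > 0" "x [^]\<^bsub>?K\<^esub> m = \<one>\<^bsub>?K\<^esub>"
    have "x i = 0" if "i < n" for i using pow[OF that, of x m] m that by simp
    moreover have "\<one>\<^bsub>?K\<^esub> \<in> carrier ?K" by (rule K.one_closed)
    ultimately show "x = \<one>\<^bsub>?K\<^esub>"
      using x unfolding carr one_sum_group by (intro PiE_ext[where k = "{..<n}" and s = H]) auto
  qed
  moreover have "finite_rank ?K"
  proof -
    have "direct_decomposition ?K (carrier ?K) {\<one>\<^bsub>?K\<^esub>}"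
      unfolding direct_decomposition_def
      using K.subgroup_self K.triv_subgroup K.r_one
      by (auto simp: set_mult_def simp del: one_sum_group mult_sum_group)
    moreover have "completely_decomposable (?K\<lparr>carrier := carrier ?K\<rparr>)"
      unfolding completely_decomposable_iff_rat_sub
      using H iso_refl[of ?K] by (auto intro!: exI[of _ n] exI[of _ H])
    ultimately obtain m L b q where F: "rational_frame ?K m L b q"
      and ker: "rational_frame.joint_kernel ?K m q = {\<one>\<^bsub>?K\<^esub>}"
      using K.frame_of_direct_decomposition by metis
    show ?thesis by (rule rational_frame.finite_rank_of_trivial_kernel[OF F ker])
  qed
  ultimately show ?thesis unfolding tffr_group_def using K.comm_group_axioms by blast
qed

section \<open>The decomposition theorem\<close>

text \<open>
  With \<open>S\<close> the common sum of rank-one groups isomorphic to both \<open>A\<^sub>0\<close> and \<open>B\<^sub>0\<close>, near isomorphism is the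
  chain \<open>A\<^sub>1 \<oplus> S \<cong> G \<cong> B\<^sub>1 \<oplus> S\<close>.
\<close>

theorem theorem2p5:
  fixes G :: "('a, 'm) monoid_scheme"
  assumes "tffr_group G"
  shows "(\<exists>A\<^sub>0 A\<^sub>1. direct_decomposition G A\<^sub>0 A\<^sub>1 \<and>
             completely_decomposable (G\<lparr>carrier := A\<^sub>0\<rparr>) \<and> clipped (G\<lparr>carrier := A\<^sub>1\<rparr>)) \<and>
         (\<forall>A\<^sub>0 A\<^sub>1 B\<^sub>0 B\<^sub>1.
             direct_decomposition G A\<^sub>0 A\<^sub>1 \<and> direct_decomposition G B\<^sub>0 B\<^sub>1 \<and>
             completely_decomposable (G\<lparr>carrier := A\<^sub>0\<rparr>) \<and>
             completely_decomposable (G\<lparr>carrier := B\<^sub>0\<rparr>) \<and>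
             clipped (G\<lparr>carrier := A\<^sub>1\<rparr>) \<and> clipped (G\<lparr>carrier := B\<^sub>1\<rparr>) \<longrightarrow>
             G\<lparr>carrier := A\<^sub>0\<rparr> \<cong> G\<lparr>carrier := B\<^sub>0\<rparr> \<and>
             nearly_isomorphic (G\<lparr>carrier := A\<^sub>1\<rparr>) (G\<lparr>carrier := B\<^sub>1\<rparr>))"
proof (intro conjI allI impI)
  interpret comm_group G using assms unfolding tffr_group_def by blast
  show "\<exists>A\<^sub>0 A\<^sub>1. direct_decomposition G A\<^sub>0 A\<^sub>1 \<and>
             completely_decomposable (G\<lparr>carrier := A\<^sub>0\<rparr>) \<and> clipped (G\<lparr>carrier := A\<^sub>1\<rparr>)"
    using assms unfolding tffr_group_def by (blast intro: decomposable_clipped_decomposition_exists)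
  fix A\<^sub>0 A\<^sub>1 B\<^sub>0 B\<^sub>1
  assume "direct_decomposition G A\<^sub>0 A\<^sub>1 \<and> direct_decomposition G B\<^sub>0 B\<^sub>1 \<and>
     completely_decomposable (G\<lparr>carrier := A\<^sub>0\<rparr>) \<and> completely_decomposable (G\<lparr>carrier := B\<^sub>0\<rparr>) \<and>
     clipped (G\<lparr>carrier := A\<^sub>1\<rparr>) \<and> clipped (G\<lparr>carrier := B\<^sub>1\<rparr>)"
  then have A: "direct_decomposition G A\<^sub>0 A\<^sub>1" "completely_decomposable (G\<lparr>carrier := A\<^sub>0\<rparr>)"
      "clipped (G\<lparr>carrier := A\<^sub>1\<rparr>)"
    and B: "direct_decomposition G B\<^sub>0 B\<^sub>1" "completely_decomposable (G\<lparr>carrier := B\<^sub>0\<rparr>)"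
      "clipped (G\<lparr>carrier := B\<^sub>1\<rparr>)"
    by blast+
  obtain n H a p where F: "rational_frame G n H a p" "rational_frame.joint_kernel G n p = A\<^sub>1"
    and S: "sum_group {..<n} (\<lambda>i. rat_sub (H i)) \<cong> G\<lparr>carrier := A\<^sub>0\<rparr>"
    using frame_of_direct_decomposition[OF A(1,2)] by metis
  obtain m K b q where F': "rational_frame G m K b q" "rational_frame.joint_kernel G m q = B\<^sub>1"
    and S': "sum_group {..<m} (\<lambda>j. rat_sub (K j)) \<cong> G\<lparr>carrier := B\<^sub>0\<rparr>"
    using frame_of_direct_decomposition[OF B(1,2)] by metis
  let ?S = "sum_group {..<n} (\<lambda>i. rat_sub (H i))"
  have tffr: "tffr_group ?S" by (rule tffr_group_sum_group[OF rational_frame.H_rat_type[OF F(1)]])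
  then interpret S: comm_group ?S unfolding tffr_group_def by blast
  have "?S \<cong> sum_group {..<m} (\<lambda>j. rat_sub (K j))"
    using F F' A(3) B(3) by (intro sum_group_iso_of_clipped_complements) auto
  then have SB: "?S \<cong> G\<lparr>carrier := B\<^sub>0\<rparr>" using S' by (rule iso_trans)
  show "G\<lparr>carrier := A\<^sub>0\<rparr> \<cong> G\<lparr>carrier := B\<^sub>0\<rparr>"
    by (rule iso_trans[OF S.iso_sym[OF S] SB])
  have "G\<lparr>carrier := A\<^sub>1\<rparr> \<times>\<times> ?S \<cong> G" by (rule direct_decomposition_DirProd_iso[OF A(1) S])
  moreover have "G\<lparr>carrier := B\<^sub>1\<rparr> \<times>\<times> ?S \<cong> G" by (rule direct_decomposition_DirProd_iso[OF B(1) SB])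
  then have "G \<cong> G\<lparr>carrier := B\<^sub>1\<rparr> \<times>\<times> ?S"
    using B(1) subgroup_imp_group unfolding direct_decomposition_def
    by (intro group.iso_sym[OF DirProd_group] S.is_group) auto
  ultimately show "nearly_isomorphic (G\<lparr>carrier := A\<^sub>1\<rparr>) (G\<lparr>carrier := B\<^sub>1\<rparr>)"
    unfolding nearly_isomorphic_def using tffr iso_trans by blast
qed

end
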